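(* Let $k$ be a positive integer. For all $n\le 2^k-1$ we have $b_{\mathbf{t},k}(n)=p_{\mathbf{t}}(n)$. For all $n\ge 2^k$ we have $$b_{\mathbf{t},k}(n)=\begin{cases}3\cdot 2^k-3, & \text{if } n\equiv 0 \pmod{2^k};\\ 3\cdot 2^k-4, & \text{otherwise.}\end{cases}$$
   Context: Let $A=\{0,1\}$ and let $\varphi:A^*\to A^*$ be the Thue--Morse morphism, $\varphi(0)=01$, $\varphi(1)=10$. The Thue--Morse word $\mathbf{t}=0110100110010110\cdots$ is the infinite fixed point of $\varphi$ starting with $0$. A factor of a word is a block of consecutive letters; $\mathrm{Fac}_n(\mathbf{t})$ is the set of factors of length $n$ of $\mathbf{t}$ and $p_{\mathbf{t}}(n)=\#\mathrm{Fac}_n(\mathbf{t})$ is its factor complexity. For finite words $u,x$, the binomial coefficient $\binom{u}{x}$ is the number of occurrences of $x$ as a subword (subsequence, not necessarily contiguous) of $u$. Two words $u,v$ are $k$-binomially equivalent, written $u\sim_k v$, if $\binom{u}{x}=\binom{v}{x}$ for all words $x$ over $A$ of length at most $k$. The $k$-binomial complexity of $\mathbf{t}$ is $b_{\mathbf{t},k}(n)=\#(\mathrm{Fac}_n(\mathbf{t})/\!\sim_k)$, the number of $\sim_k$-classes among factors of length $n$. *)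

theory Defs
  imports Main "HOL-Number_Theory.Cong"
begin

text \<open>The alphabet \<open>{0, 1}\<close> is the type \<^typ>\<open>bool\<close>, with \<open>0 = False\<close> and \<open>1 = True\<close>.
  Finite words are lists, infinite words are functions on \<^typ>\<open>nat\<close>.\<close>

fun tm_letter :: "bool \<Rightarrow> bool list" where
  "tm_letter False = [False, True]"
| "tm_letter True = [True, False]"

definition tm_morphism :: "bool list \<Rightarrow> bool list" where
  "tm_morphism w = concat (map tm_letter w)"

text \<open>Extension of the morphism to infinite words. Both letters have an image of length 2, so the
  letter at position \<open>i\<close> of the image comes from the letter at position \<open>i div 2\<close>;
  see \<open>tm_morphism_inf_prefix\<close> for the relation with \<^const>\<open>tm_morphism\<close>.\<close>

definition tm_morphism_inf :: "(nat \<Rightarrow> bool) \<Rightarrow> nat \<Rightarrow> bool" where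
  "tm_morphism_inf w i = tm_letter (w (i div 2)) ! (i mod 2)"

lemma tm_morphism_inf_prefix:
  "map (tm_morphism_inf w) [0..<2 * n] = tm_morphism (map w [0..<n])"
proof (induction n)
  case 0
  then show ?case by (simp add: tm_morphism_def)
next
  case (Suc n)
  have "[0..<2 * Suc n] = [0..<2 * n] @ [2 * n, Suc (2 * n)]" by simp
  moreover have "[tm_morphism_inf w (2 * n), tm_morphism_inf w (Suc (2 * n))] = tm_letter (w n)"
    by (cases "w n") (simp_all add: tm_morphism_inf_def)
  ultimately show ?case
    using Suc.IH by (simp add: tm_morphism_def)
qed

definition thue_morse :: "nat \<Rightarrow> bool" where
  "thue_morse = (THE w. tm_morphism_inf w = w \<and> w 0 = False)"

fun tm_digit :: "nat \<Rightarrow> bool" where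
  "tm_digit n = (if n = 0 then False else tm_letter (tm_digit (n div 2)) ! (n mod 2))"

declare tm_digit.simps [simp del]

lemma tm_fixed_point_ex1: "\<exists>!w. tm_morphism_inf w = w \<and> w 0 = False"
proof (rule ex1I[of _ tm_digit])
  show "tm_morphism_inf tm_digit = tm_digit \<and> tm_digit 0 = False"
  proof (intro conjI ext)
    show z: "tm_digit 0 = False" by (simp add: tm_digit.simps)
    show "tm_morphism_inf tm_digit n = tm_digit n" for n
      by (cases "n = 0") (simp_all add: tm_morphism_inf_def z tm_digit.simps[of n])
  qed
next
  fix w assume w: "tm_morphism_inf w = w \<and> w 0 = False"
  have "w n = tm_digit n" for n
  proof (induction n rule: less_induct)
    case (less n)
    show ?case
    proof (cases "n = 0")
      case True
      then show ?thesis using w by (simp add: tm_digit.simps)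
    next
      case False
      then have "w (n div 2) = tm_digit (n div 2)" by (intro less) simp
      moreover have "w n = tm_letter (w (n div 2)) ! (n mod 2)"
        using w by (metis tm_morphism_inf_def)
      ultimately show ?thesis using False by (simp add: tm_digit.simps[of n])
    qed
  qed
  then show "w = tm_digit" by blast
qed

lemma thue_morse_fixed_point: "tm_morphism_inf thue_morse = thue_morse" "thue_morse 0 = False"
  using theI'[OF tm_fixed_point_ex1] by (simp_all add: thue_morse_def)

definition factors :: "(nat \<Rightarrow> 'a) \<Rightarrow> nat \<Rightarrow> 'a list set" where
  "factors w n = {map w [i..<i + n] | i. True}"

definition factor_complexity :: "(nat \<Rightarrow> 'a) \<Rightarrow> nat \<Rightarrow> nat" where
  "factor_complexity w n = card (factors w n)"

text \<open>An occurrence of \<open>x\<close> as a (scattered) subword of \<open>u\<close> is a set of positions of \<open>u\<close> whose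
  letters, read in increasing order, spell \<open>x\<close>.\<close>

definition word_binomial :: "'a list \<Rightarrow> 'a list \<Rightarrow> nat" where
  "word_binomial u x = card {I. I \<subseteq> {..<length u} \<and> nths u I = x}"

definition binomial_equiv :: "nat \<Rightarrow> ('a list \<times> 'a list) set" where
  "binomial_equiv k =
     {(u, v). \<forall>x. length x \<le> k \<longrightarrow> word_binomial u x = word_binomial v x}"

definition binomial_complexity :: "(nat \<Rightarrow> 'a) \<Rightarrow> nat \<Rightarrow> nat \<Rightarrow> nat" where
  "binomial_complexity w k n =
     card (factors w n // (binomial_equiv k \<inter> factors w n \<times> factors w n))"

lemma equiv_binomial_equiv: "equiv A (binomial_equiv k \<inter> A \<times> A)"
  by (rule equivI) (auto simp: binomial_equiv_def refl_on_def sym_def trans_def)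

end

theory Submission
  imports Defs
begin

text \<open>
  Sending a letter \<open>a\<close> to \<open>1 + X\<^sub>a\<close> turns words into noncommutative power series whose
  coefficients are the binomial coefficients of the word, so \<open>u\<close> and \<open>v\<close> are
  \<open>k\<close>-binomially equivalent iff the difference of their series has order greater than \<open>k\<close>, and
  common prefixes and suffixes can be cancelled.
  Let \<open>A\<close>, \<open>B\<close> be the series of \<open>\<phi>\<^sup>j(0)\<close>, \<open>\<phi>\<^sup>j(1)\<close> and \<open>D\<^sub>j = A - B\<close>. Then
  \<open>D\<^sub>j\<^sub>+\<^sub>1 = D\<^sub>j B - B D\<^sub>j\<close>, hence \<open>D\<^sub>j\<close> has order exactly \<open>j + 1\<close>. Expanding in \<open>D\<^sub>j\<close> shows that
  \<open>\<phi>\<^sup>j(w)\<close>, for \<open>w\<close> of given length, determines up to \<open>(j+1)\<close>-binomial equivalence exactly the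
  number of zeros of \<open>w\<close>, and up to \<open>(j+2)\<close>-equivalence also the sum of their positions.

  For factors \<open>w\<close> of the Thue--Morse word both statistics have closed forms in the partial sums of
  the \<open>\<plusminus>1\<close> sequence, which vanish at even arguments. Comparing them shows, by induction on \<open>j\<close>,
  that \<open>(j+1)\<close>-equivalent factors of length at least \<open>2\<^sup>j\<^sup>+\<^sup>1\<close> are cut at the same offset modulo
  \<open>2\<^sup>j\<close> and have the same partial blocks at both ends. The classes are therefore given by the offset,
  the letters behind the partial blocks and the number of zeros in between; an offset contributes 6
  such triples if both ends are cut inside a block, 4 if one of them is, and otherwise 3 or 2
  according to the parity of the number of blocks.
\<close>

section \<open>Noncommutative power series and binomial equivalence\<close>

typedef 'a ncseries = "UNIV :: ('a list \<Rightarrow> int) set"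
  morphisms nc_coeff Abs_ncseries ..

lemma nc_coeff_Abs [simp]: "nc_coeff (Abs_ncseries f) = f"
  by (simp add: Abs_ncseries_inverse)

lemma ncseries_eqI: "(\<And>x. nc_coeff f x = nc_coeff g x) \<Longrightarrow> f = g"
  by (metis ext nc_coeff_inject)

text \<open>The Cauchy product, by recursion on the first letter instead of as a sum over all
  factorisations of the word; this makes associativity a plain induction.\<close>

fun conv :: "('a list \<Rightarrow> int) \<Rightarrow> ('a list \<Rightarrow> int) \<Rightarrow> 'a list \<Rightarrow> int" where
  "conv f g [] = f [] * g []"
| "conv f g (a # x) = f [] * g (a # x) + conv (\<lambda>y. f (a # y)) g x"

lemma conv_add_left: "conv (\<lambda>y. f y + g y) h x = conv f h x + conv g h x"
  by (induction x arbitrary: f g) (simp_all add: algebra_simps)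

lemma conv_add_right: "conv h (\<lambda>y. f y + g y) x = conv h f x + conv h g x"
  by (induction x arbitrary: h) (simp_all add: algebra_simps)

lemma conv_scale_left: "conv (\<lambda>y. c * f y) g x = c * conv f g x"
  by (induction x arbitrary: f) (simp_all add: algebra_simps)

lemma conv_zero_left: "conv (\<lambda>y. 0) g x = 0"
  by (induction x) simp_all

lemma conv_assoc: "conv (conv f g) h x = conv f (conv g h) x"
proof (induction x arbitrary: f g)
  case (Cons a x)
  have "conv (\<lambda>y. conv f g (a # y)) h x
      = f [] * conv (\<lambda>y. g (a # y)) h x + conv (\<lambda>y. f (a # y)) (conv g h) x"
    by (simp add: conv_add_left conv_scale_left Cons.IH)
  then show ?case by (simp add: algebra_simps)
qed (simp add: algebra_simps)

instantiation ncseries :: (type) ring_1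
begin

definition "0 = Abs_ncseries (\<lambda>x. 0)"
definition "1 = Abs_ncseries (\<lambda>x. if x = [] then 1 else 0)"
definition "f + g = Abs_ncseries (\<lambda>x. nc_coeff f x + nc_coeff g x)"
definition "f - g = Abs_ncseries (\<lambda>x. nc_coeff f x - nc_coeff g x)"
definition "- f = Abs_ncseries (\<lambda>x. - nc_coeff f x)"
definition "f * g = Abs_ncseries (conv (nc_coeff f) (nc_coeff g))"

instance
proof
  fix f g h :: "'a ncseries"
  show "f * g * h = f * (g * h)"
    by (rule ncseries_eqI) (simp add: times_ncseries_def conv_assoc)
  have "conv (\<lambda>x. if x = [] then 1 else 0) f' x = f' x" for f' :: "'a list \<Rightarrow> int" and x
    by (cases x) (simp_all add: conv_zero_left)
  then show "1 * f = f"
    by (intro ncseries_eqI) (simp add: times_ncseries_def one_ncseries_def)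
  have "conv f' (\<lambda>x. if x = [] then 1 else 0) x = f' x" for f' :: "'a list \<Rightarrow> int" and x
    by (induction x arbitrary: f') simp_all
  then show "f * 1 = f"
    by (intro ncseries_eqI) (simp add: times_ncseries_def one_ncseries_def)
  have "nc_coeff (0 :: 'a ncseries) [] \<noteq> nc_coeff 1 []"
    by (simp add: zero_ncseries_def one_ncseries_def)
  then show "(0 :: 'a ncseries) \<noteq> 1" by auto
  show "f + g + h = f + (g + h)" "f + g = g + f" "0 + f = f" "- f + f = 0" "f - g = f + - g"
    by (rule ncseries_eqI; simp add: plus_ncseries_def minus_ncseries_def uminus_ncseries_def
        zero_ncseries_def)+
  show "(f + g) * h = f * h + g * h" "f * (g + h) = f * g + f * h"
    by (rule ncseries_eqI; simp add: plus_ncseries_def times_ncseries_def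
        conv_add_left conv_add_right)+
qed

end

lemma nc_coeff_simps [simp]:
  "nc_coeff 0 x = 0"
  "nc_coeff 1 x = (if x = [] then 1 else 0)"
  "nc_coeff (f + g) x = nc_coeff f x + nc_coeff g x"
  "nc_coeff (f - g) x = nc_coeff f x - nc_coeff g x"
  "nc_coeff (- f) x = - nc_coeff f x"
  by (simp_all add: plus_ncseries_def minus_ncseries_def uminus_ncseries_def
      zero_ncseries_def one_ncseries_def)

lemma nc_coeff_mult: "nc_coeff (f * g) x = conv (nc_coeff f) (nc_coeff g) x"
  by (simp add: times_ncseries_def)

lemma nc_coeff_mult_Nil [simp]: "nc_coeff (f * g) [] = nc_coeff f [] * nc_coeff g []"
  by (simp add: nc_coeff_mult)

lemma nc_coeff_of_int_mult [simp]: "nc_coeff (of_int c * f) x = c * nc_coeff f x"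
proof (induction c rule: int_induct[of _ 0])
  case (step1 i)
  then show ?case by (simp add: algebra_simps)
next
  case (step2 i)
  then show ?case by (simp add: algebra_simps)
qed simp

lemma nc_coeff_of_int [simp]: "nc_coeff (of_int c) x = (if x = [] then c else 0)"
  using nc_coeff_of_int_mult[of c 1 x] by simp

section \<open>Order of a power series\<close>

definition vanishes :: "nat \<Rightarrow> 'a ncseries \<Rightarrow> bool" where
  "vanishes k f \<longleftrightarrow> (\<forall>x. length x < k \<longrightarrow> nc_coeff f x = 0)"

lemma vanishes_mono: "vanishes k f \<Longrightarrow> l \<le> k \<Longrightarrow> vanishes l f"
  by (auto simp: vanishes_def)

lemma vanishes_0 [simp]: "vanishes 0 f" "vanishes k 0"
  by (simp_all add: vanishes_def)

lemma vanishes_add: "vanishes k f \<Longrightarrow> vanishes k g \<Longrightarrow> vanishes k (f + g)"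
  and vanishes_diff: "vanishes k f \<Longrightarrow> vanishes k g \<Longrightarrow> vanishes k (f - g)"
  by (simp_all add: vanishes_def)

lemma vanishes_1: "vanishes (Suc 0) f \<longleftrightarrow> nc_coeff f [] = 0"
  by (simp add: vanishes_def)

lemma conv_vanish:
  assumes "\<And>y. length y < k \<Longrightarrow> f y = 0" and "\<And>y. length y < l \<Longrightarrow> g y = 0"
    and "length x < k + l"
  shows "conv f g x = 0"
  using assms
proof (induction x arbitrary: f k)
  case Nil
  then show ?case by (cases "k = 0") auto
next
  case (Cons a x)
  have "conv (\<lambda>y. f (a # y)) g x = 0"
    by (rule Cons.IH[of "k - 1"]) (use Cons.prems in auto)
  moreover have "f [] * g (a # x) = 0"
    using Cons.prems by (cases "k = 0") auto
  ultimately show ?case by simp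
qed

lemma vanishes_mult:
  assumes "vanishes k f" "vanishes l g"
  shows "vanishes (k + l) (f * g)"
  using assms conv_vanish[of k "nc_coeff f" l "nc_coeff g"] by (simp add: vanishes_def nc_coeff_mult)

lemma vanishes_mult_left: "vanishes k f \<Longrightarrow> vanishes k (g * f)"
  and vanishes_mult_right: "vanishes k f \<Longrightarrow> vanishes k (f * g)"
  using vanishes_mult[of 0 g k f] vanishes_mult[of k f 0 g] by simp_all

text \<open>A series with constant term 1 is a unit: in \<open>f = p * f - (p - 1) * f\<close> the
  second term has order one higher than \<open>f\<close>, so the order of \<open>f\<close> climbs
  step by step up to that of \<open>p * f\<close>.\<close>

lemma vanishes_mult_left_iff:
  assumes "nc_coeff p [] = 1"
  shows "vanishes k (p * f) \<longleftrightarrow> vanishes k f"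
proof
  assume pf: "vanishes k (p * f)"
  have "vanishes j f" if "j \<le> k" for j
    using that
  proof (induction j)
    case (Suc j)
    have "vanishes (Suc 0 + j) ((p - 1) * f)"
      by (rule vanishes_mult) (use Suc assms in \<open>auto simp: vanishes_1\<close>)
    moreover have "vanishes (Suc j) (p * f)"
      using pf Suc.prems vanishes_mono by blast
    ultimately have "vanishes (Suc j) (p * f - (p - 1) * f)"
      by (intro vanishes_diff) simp_all
    then show ?case by (simp add: algebra_simps)
  qed simp
  then show "vanishes k f" by simp
qed (rule vanishes_mult_left)

lemma vanishes_mult_right_iff:
  assumes "nc_coeff p [] = 1"
  shows "vanishes k (f * p) \<longleftrightarrow> vanishes k f"
proof
  assume pf: "vanishes k (f * p)"
  have "vanishes j f" if "j \<le> k" for j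
    using that
  proof (induction j)
    case (Suc j)
    have "vanishes (j + Suc 0) (f * (p - 1))"
      by (rule vanishes_mult) (use Suc assms in \<open>auto simp: vanishes_1\<close>)
    moreover have "vanishes (Suc j) (f * p)"
      using pf Suc.prems vanishes_mono by blast
    ultimately have "vanishes (Suc j) (f * p - f * (p - 1))"
      by (intro vanishes_diff) simp_all
    then show ?case by (simp add: algebra_simps)
  qed simp
  then show "vanishes k f" by simp
qed (rule vanishes_mult_right)

text \<open>In the lowest possible degree of \<open>f\<close> only the constant term of the other
  factor contributes.\<close>

lemma nc_coeff_mult_lowest:
  assumes "vanishes (length x) f"
  shows "nc_coeff (g * f) x = nc_coeff g [] * nc_coeff f x"
proof -
  define c where "c = nc_coeff g []"
  have "vanishes (Suc 0 + length x) ((g - of_int c) * f)"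
    using assms by (intro vanishes_mult) (simp_all add: vanishes_1 c_def)
  then have "nc_coeff ((g - of_int c) * f) x = 0"
    by (simp add: vanishes_def)
  then show ?thesis by (simp add: algebra_simps c_def)
qed

text \<open>One degree above the lowest, only two factorisations of \<open>x @ [a]\<close> survive:
  those whose left part has at least \<open>length x\<close> letters.\<close>

lemma nc_coeff_mult_snoc:
  assumes "vanishes (length x) f"
  shows "nc_coeff (f * g) (x @ [a]) = nc_coeff f (x @ [a]) * nc_coeff g [] + nc_coeff f x * nc_coeff g [a]"
proof -
  have "conv f' g' (x @ [a]) = f' (x @ [a]) * g' [] + f' x * g' [a]"
    if "\<And>y. length y < length x \<Longrightarrow> f' y = 0" for f' g' :: "'a list \<Rightarrow> int"
    using that by (induction x arbitrary: f') auto
  then show ?thesis using assms by (simp add: nc_coeff_mult vanishes_def)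
qed

lemma nc_coeff_mult_Cons:
  assumes "vanishes (length x) f"
  shows "nc_coeff (g * f) (a # x) = nc_coeff g [] * nc_coeff f (a # x) + nc_coeff g [a] * nc_coeff f x"
proof -
  \<comment> \<open>The left derivative of \<open>g\<close> by \<open>a\<close> has constant term
    \<open>nc_coeff g [a]\<close>, and its product with \<open>f\<close> is the recursive part of
    the convolution.\<close>
  have "nc_coeff (Abs_ncseries (\<lambda>y. nc_coeff g (a # y)) * f) x = nc_coeff g [a] * nc_coeff f x"
    using nc_coeff_mult_lowest[OF assms] by simp
  then show ?thesis by (simp add: nc_coeff_mult)
qed

section \<open>The Magnus embedding and binomial coefficients\<close>

definition nc_var :: "'a \<Rightarrow> 'a ncseries" where
  "nc_var a = Abs_ncseries (\<lambda>x. if x = [a] then 1 else 0)"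

definition magnus :: "'a list \<Rightarrow> 'a ncseries" where
  "magnus u = prod_list (map (\<lambda>a. 1 + nc_var a) u)"

lemma nc_coeff_var [simp]: "nc_coeff (nc_var a) x = (if x = [a] then 1 else 0)"
  by (simp add: nc_var_def)

lemma magnus_Nil [simp]: "magnus [] = 1"
  and magnus_Cons: "magnus (a # u) = (1 + nc_var a) * magnus u"
  and magnus_append [simp]: "magnus (u @ v) = magnus u * magnus v"
  by (simp_all add: magnus_def)

lemma nc_coeff_magnus_Nil [simp]: "nc_coeff (magnus u) [] = 1"
  by (induction u) (simp_all add: magnus_Cons)

lemma nc_coeff_var_mult:
  "nc_coeff (nc_var a * f) x = (case x of [] \<Rightarrow> 0 | b # y \<Rightarrow> if b = a then nc_coeff f y else 0)"
proof (cases x)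
  case (Cons b y)
  have "conv (\<lambda>z. if z = [] then 1 else 0) (nc_coeff f) y = nc_coeff (1 * f) y"
    unfolding nc_coeff_mult by (rule arg_cong[where f = "\<lambda>h. conv h _ _"]) auto
  then show ?thesis using Cons by (simp add: nc_coeff_mult conv_zero_left)
qed simp

lemma word_binomial_Nil: "word_binomial [] x = (if x = [] then 1 else 0)"
proof -
  have "{I. I \<subseteq> {..<length []} \<and> nths [] I = x} = (if x = [] then {{}} else {})" by auto
  then show ?thesis by (simp add: word_binomial_def)
qed

text \<open>Occurrences in \<open>a # u\<close> either avoid position 0 or use it; shifting the
  remaining positions down by one gives occurrences in \<open>u\<close>. Multiplication by
  \<open>1 + nc_var a\<close> obeys the same recursion on coefficients.\<close>

lemma word_binomial_Cons:
  "word_binomial (a # u) x =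
     word_binomial u x + (case x of [] \<Rightarrow> 0 | b # y \<Rightarrow> if b = a then word_binomial u y else 0)"
proof -
  let ?O = "\<lambda>u x. {I. I \<subseteq> {..<length u} \<and> nths u I = x}"
  let ?A = "image Suc ` ?O u x"
  let ?B = "(\<lambda>I. insert 0 (Suc ` I)) ` (case x of [] \<Rightarrow> {} | b # y \<Rightarrow> if b = a then ?O u y else {})"
  have fin: "finite (?O u x)" for u :: "'a list" and x
    by (rule finite_subset[of _ "Pow {..<length u}"]) auto
  have shift: "{j. Suc j \<in> Suc ` I} = I" "{j. Suc j \<in> insert 0 (Suc ` I)} = I" for I
    by auto
  have "?O (a # u) x = ?A \<union> ?B"
  proof (intro equalityI subsetI)
    fix I assume I: "I \<in> ?O (a # u) x"
    define J where "J = {j. Suc j \<in> I}"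
    have J: "J \<subseteq> {..<length u}" using I by (auto simp: J_def)
    show "I \<in> ?A \<union> ?B"
    proof (cases "0 \<in> I")
      case True
      have "I = insert 0 (Suc ` J)"
        unfolding J_def using True by (auto simp: image_iff) (metis not0_implies_Suc)
      moreover have "x = a # nths u J" using I True by (simp add: nths_Cons J_def)
      ultimately show ?thesis using J by auto
    next
      case False
      have "I = Suc ` J"
        unfolding J_def using False by (auto simp: image_iff) (metis not0_implies_Suc)
      moreover have "x = nths u J" using I False by (simp add: nths_Cons J_def)
      ultimately show ?thesis using J by auto
    qed
  next
    fix I assume "I \<in> ?A \<union> ?B"
    then show "I \<in> ?O (a # u) x"
      by (auto simp: nths_Cons shift split: list.splits if_splits)
  qed
  moreover have "?A \<inter> ?B = {}" by auto
  moreover have "card ?A = word_binomial u x"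
    unfolding word_binomial_def
    by (rule card_image) (auto simp: inj_on_def inj_image_eq_iff)
  moreover have "card ?B = (case x of [] \<Rightarrow> 0 | b # y \<Rightarrow> if b = a then word_binomial u y else 0)"
  proof -
    have "inj_on (\<lambda>I. insert 0 (Suc ` I)) X" for X
      by (rule inj_onI) (metis shift(2))
    then show ?thesis
      by (subst card_image) (auto simp: word_binomial_def split: list.splits)
  qed
  moreover have "finite ?A" "finite ?B"
    using fin by (auto split: list.splits)
  ultimately show ?thesis
    by (simp add: word_binomial_def[of "a # u"] card_Un_disjoint)
qed

lemma nc_coeff_magnus: "nc_coeff (magnus u) x = int (word_binomial u x)"
proof (induction u arbitrary: x)
  case Nil
  then show ?case by (simp add: word_binomial_Nil)
next
  case (Cons a u)
  then show ?case
    by (simp add: magnus_Cons distrib_right nc_coeff_var_mult word_binomial_Cons split: list.splits)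
qed

lemma binomial_equiv_iff_magnus:
  "(u, v) \<in> binomial_equiv k \<longleftrightarrow> vanishes (Suc k) (magnus u - magnus v)"
  by (simp add: binomial_equiv_def vanishes_def nc_coeff_magnus less_Suc_eq_le)

text \<open>The common prefix and suffix multiply the difference of the series by units on both
  sides, which preserves its order.\<close>

lemma binomial_equiv_cancel:
  "(p @ u @ s, p @ v @ s) \<in> binomial_equiv k \<longleftrightarrow> (u, v) \<in> binomial_equiv k"
proof -
  have "magnus (p @ u @ s) - magnus (p @ v @ s) = magnus p * (magnus u - magnus v) * magnus s"
    by (simp add: algebra_simps)
  then show ?thesis
    by (simp add: binomial_equiv_iff_magnus vanishes_mult_left_iff vanishes_mult_right_iff)
qed

lemma binomial_equiv_mono: "(u, v) \<in> binomial_equiv k \<Longrightarrow> l \<le> k \<Longrightarrow> (u, v) \<in> binomial_equiv l"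
  by (auto simp: binomial_equiv_def)

section \<open>Images of words under powers of the morphism\<close>

lemma tm_morphism_simps [simp]:
  "tm_morphism [] = []"
  "tm_morphism (a # w) = a # (\<not> a) # tm_morphism w"
  by (cases a; simp add: tm_morphism_def)+

lemma tm_morphism_append [simp]: "tm_morphism (u @ v) = tm_morphism u @ tm_morphism v"
  by (simp add: tm_morphism_def)

lemma tm_power_append [simp]: "(tm_morphism ^^ j) (u @ v) = (tm_morphism ^^ j) u @ (tm_morphism ^^ j) v"
  by (induction j) simp_all

lemma tm_power_Nil [simp]: "(tm_morphism ^^ j) [] = []"
  by (induction j) simp_all

lemma tm_power_Cons: "(tm_morphism ^^ j) (a # w) = (tm_morphism ^^ j) [a] @ (tm_morphism ^^ j) w"
  using tm_power_append[of j "[a]" w] by simp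

lemma tm_power_Suc_letter:
  "(tm_morphism ^^ Suc j) [a] = (tm_morphism ^^ j) [a] @ (tm_morphism ^^ j) [\<not> a]"
  using tm_power_Cons[of j a "[\<not> a]"] by (simp add: funpow_swap1)

section \<open>Order of the difference of the two blocks\<close>

definition tm_block :: "nat \<Rightarrow> bool \<Rightarrow> bool ncseries" where
  "tm_block j a = magnus ((tm_morphism ^^ j) [a])"

definition tm_gap :: "nat \<Rightarrow> bool ncseries" where
  "tm_gap j = tm_block j False - tm_block j True"

lemma tm_block_Suc: "tm_block (Suc j) a = tm_block j a * tm_block j (\<not> a)"
  unfolding tm_block_def tm_power_Suc_letter by simp

lemma nc_coeff_tm_block_Nil [simp]: "nc_coeff (tm_block j a) [] = 1"
  by (simp add: tm_block_def)

lemma tm_block_False: "tm_block j False = tm_block j True + tm_gap j"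
  by (simp add: tm_gap_def)

text \<open>With \<open>A\<close> and \<open>B\<close> the two blocks, the next gap is
  \<open>A * B - B * A\<close>; substituting \<open>A = B + tm_gap j\<close> cancels the squares of
  \<open>B\<close> and leaves a commutator.\<close>

lemma tm_gap_Suc: "tm_gap (Suc j) = tm_gap j * tm_block j True - tm_block j True * tm_gap j"
  by (simp add: tm_gap_def tm_block_Suc algebra_simps)

lemma vanishes_mult_minus_1:
  assumes "vanishes k f" "nc_coeff g [] = 1"
  shows "vanishes (Suc k) ((g - 1) * f)" "vanishes (Suc k) (f * (g - 1))"
  using vanishes_mult[of "Suc 0" "g - 1" k f] vanishes_mult[of k f "Suc 0" "g - 1"] assms
  by (simp_all add: vanishes_1)

lemma vanishes_tm_gap: "vanishes (Suc j) (tm_gap j)"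
proof (induction j)
  case 0
  then show ?case by (simp add: tm_gap_def vanishes_1)
next
  case (Suc j)
  \<comment> \<open>Since 1 is central, the commutator may be taken with \<open>B - 1\<close>, which
    has positive order.\<close>
  have "tm_gap (Suc j) = tm_gap j * (tm_block j True - 1) - (tm_block j True - 1) * tm_gap j"
    by (simp add: tm_gap_Suc algebra_simps)
  then show ?case
    using Suc by (simp only:) (intro vanishes_diff vanishes_mult_minus_1; simp)
qed

lemma nc_coeff_mult_letter:
  "nc_coeff f [] = 1 \<Longrightarrow> nc_coeff g [] = 1 \<Longrightarrow> nc_coeff (f * g) [a] = nc_coeff f [a] + nc_coeff g [a]"
  by (simp add: nc_coeff_mult)

lemma tm_block_letter_pos: "nc_coeff (tm_block j True) [True] > 0"
proof (induction j)
  case 0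
  then show ?case by (simp add: tm_block_def magnus_def)
next
  case (Suc j)
  have "nc_coeff (tm_block j False) [True] \<ge> 0"
    by (simp add: tm_block_def nc_coeff_magnus)
  then show ?case using Suc by (simp add: tm_block_Suc nc_coeff_mult_letter)
qed

text \<open>Appending and prepending \<open>True\<close> to a power of \<open>True\<close> give the
  same word, so the two products of the commutator have equal coefficients there.\<close>

lemma tm_gap_coeff_True: "nc_coeff (tm_gap (Suc j)) (replicate (Suc (Suc j)) True) = 0"
proof -
  let ?y = "replicate (Suc j) True"
  have v: "vanishes (length ?y) (tm_gap j)" using vanishes_tm_gap by simp
  have "?y @ [True] = True # ?y" by (simp add: replicate_append_same)
  then show ?thesis
    using nc_coeff_mult_snoc[OF v, of "tm_block j True" True]
      nc_coeff_mult_Cons[OF v, of "tm_block j True" True]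
    by (simp add: tm_gap_Suc)
qed

text \<open>This coefficient witnesses that the order of \<^term>\<open>tm_gap j\<close> is not larger than \<open>j + 1\<close>.\<close>

lemma tm_gap_coeff_pos: "nc_coeff (tm_gap j) (False # replicate j True) > 0"
proof (induction j)
  case 0
  then show ?case by (simp add: tm_gap_def tm_block_def magnus_def)
next
  case (Suc j)
  let ?y = "False # replicate j True" and ?z = "replicate (Suc j) True"
  have v: "vanishes (length ?y) (tm_gap j)" "vanishes (length ?z) (tm_gap j)"
    using vanishes_tm_gap by simp_all
  have "?y @ [True] = False # ?z" by (simp add: replicate_append_same)
  \<comment> \<open>The mixed term of the second product vanishes: for \<open>j = 0\<close> the
    block is the single letter \<open>True\<close>, and for larger \<open>j\<close> the gap has no
    coefficient at a power of \<open>True\<close>.\<close>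
  moreover have "nc_coeff (tm_block j True) [False] * nc_coeff (tm_gap j) ?z = 0"
  proof (cases j)
    case 0
    then show ?thesis by (simp add: tm_block_def magnus_def)
  next
    case (Suc i)
    then show ?thesis using tm_gap_coeff_True[of i] by simp
  qed
  ultimately have "nc_coeff (tm_gap (Suc j)) (False # ?z)
      = nc_coeff (tm_gap j) ?y * nc_coeff (tm_block j True) [True]"
    using nc_coeff_mult_snoc[OF v(1), of "tm_block j True" True]
      nc_coeff_mult_Cons[OF v(2), of "tm_block j True" False]
    by (simp add: tm_gap_Suc)
  then show ?case using Suc.IH tm_block_letter_pos[of j] by simp
qed

section \<open>Expansions of the images in powers of the gap\<close>

text \<open>Each zero contributes the number of letters behind it, which is the number of blocks
  that its factor \<open>tm_gap j\<close> crosses when moved to the right end of the product. For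
  fixed length and number of zeros this amounts to the sum of their positions.\<close>

fun zero_weight :: "bool list \<Rightarrow> nat" where
  "zero_weight [] = 0"
| "zero_weight (a # w) = zero_weight w + (if a then 0 else length w)"

lemma magnus_tm_power_Cons:
  "magnus ((tm_morphism ^^ j) (a # w)) = tm_block j a * magnus ((tm_morphism ^^ j) w)"
  by (subst tm_power_Cons) (simp add: tm_block_def)

lemma nc_coeff_power_Nil [simp]: "nc_coeff (f ^ n) [] = nc_coeff f [] ^ n"
  by (induction n) simp_all

text \<open>A zero contributes \<open>B + D\<close> and a one contributes \<open>B\<close>. Modulo
  order \<open>j + 2\<close>, products with two factors \<open>D\<close> vanish, and next to a
  single \<open>D\<close> every \<open>B\<close> may be replaced by 1.\<close>

lemma magnus_tm_power_order1:
  "vanishes (Suc (Suc j)) (magnus ((tm_morphism ^^ j) w)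
     - (tm_block j True ^ length w + of_int (int (count_list w False)) * tm_gap j))"
proof (induction w)
  case (Cons a w)
  define B D n N where "B = tm_block j True" and "D = tm_gap j" and "n = length w"
    and "N = (of_int (int (count_list w False)) :: bool ncseries)"
  define r where "r = magnus ((tm_morphism ^^ j) w) - (B ^ n + N * D)"
  have r: "vanishes (Suc (Suc j)) r"
    using Cons.IH by (simp only: r_def B_def D_def n_def N_def)
  have w: "magnus ((tm_morphism ^^ j) w) = B ^ n + N * D + r" by (simp add: r_def)
  have D: "vanishes (Suc j) D" by (simp add: D_def vanishes_tm_gap)
  have NB: "N * f = f * N" for f unfolding N_def by (rule mult_of_int_commute)
  have BND: "B * (N * D) = N * (B * D)" "D * (N * D) = N * (D * D)"
    by (metis NB mult.assoc)+
  have 1: "vanishes (Suc (Suc j)) (N * ((B - 1) * D))"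
    by (intro vanishes_mult_left vanishes_mult_minus_1 D) (simp add: B_def)
  have 2: "vanishes (Suc (Suc j)) (D * (B ^ n - 1))"
    by (intro vanishes_mult_minus_1 D) (simp add: B_def)
  have 3: "vanishes (Suc (Suc j)) (N * (D * D))"
    by (intro vanishes_mult_left vanishes_mono[OF vanishes_mult[OF D D]]) simp
  show ?case
  proof (cases a)
    case True
    have "magnus ((tm_morphism ^^ j) (a # w)) - (B ^ Suc n + N * D) = B * r + N * ((B - 1) * D)"
      unfolding magnus_tm_power_Cons w using True
      by (simp add: B_def[symmetric] algebra_simps BND)
    then show ?thesis
      using True r 1 by (simp add: B_def D_def n_def N_def vanishes_add vanishes_mult_left)
  next
    case False
    have "magnus ((tm_morphism ^^ j) (a # w)) - (B ^ Suc n + (N + 1) * D)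
        = (B + D) * r + N * ((B - 1) * D) + D * (B ^ n - 1) + N * (D * D)"
      unfolding magnus_tm_power_Cons w using False
      by (simp add: tm_block_False B_def[symmetric] D_def[symmetric] algebra_simps BND)
    then have "vanishes (Suc (Suc j))
        (magnus ((tm_morphism ^^ j) (a # w)) - (B ^ Suc n + (N + 1) * D))"
      using r 1 2 3 by (simp add: vanishes_add vanishes_mult_left)
    then show ?thesis
      using False by (simp add: B_def D_def n_def N_def add.commute)
  qed
qed simp

text \<open>Up to order \<open>j + 2\<close> the two series differ by \<open>c\<close> times the
  gap, where \<open>c\<close> is the difference of the numbers of zeros. The gap has a nonzero
  coefficient in degree \<open>j + 1\<close>, so this vanishes only for
  \<open>c = 0\<close>.\<close>

lemma binomial_equiv_tm_power_iff:
  assumes "length w = length w'"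
  shows "((tm_morphism ^^ j) w, (tm_morphism ^^ j) w') \<in> binomial_equiv (Suc j)
    \<longleftrightarrow> count_list w False = count_list w' False"
proof -
  define c where "c = int (count_list w False) - int (count_list w' False)"
  define F where "F = magnus ((tm_morphism ^^ j) w) - magnus ((tm_morphism ^^ j) w')"
  have v: "vanishes (Suc (Suc j)) (F - of_int c * tm_gap j)"
    using vanishes_diff[OF magnus_tm_power_order1[of j w] magnus_tm_power_order1[of j w']] assms
    by (simp add: F_def c_def algebra_simps)
  have "vanishes (Suc (Suc j)) F \<longleftrightarrow> c = 0"
  proof
    assume F: "vanishes (Suc (Suc j)) F"
    have "vanishes (Suc (Suc j)) (of_int c * tm_gap j)"
      using vanishes_diff[OF F v] by simp
    then have "nc_coeff (of_int c * tm_gap j) (False # replicate j True) = 0"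
      unfolding vanishes_def by (elim allE impE) simp_all
    then show "c = 0" using tm_gap_coeff_pos[of j] by simp
  next
    assume "c = 0"
    then show "vanishes (Suc (Suc j)) F" using v by simp
  qed
  then show ?thesis by (simp add: binomial_equiv_iff_magnus F_def c_def)
qed

text \<open>Each of the \<open>n\<close> transpositions of \<open>D\<close> with a \<open>B\<close>
  leaves one commutator \<open>tm_gap (Suc j)\<close>; the factors \<open>B\<close> around it change
  it only in order \<open>j + 3\<close>.\<close>

lemma tm_gap_power_commute:
  "vanishes (j + 3) (tm_gap j * tm_block j True ^ n - tm_block j True ^ n * tm_gap j
     - of_int (int n) * tm_gap (Suc j))"
proof (induction n)
  case (Suc n)
  define B D E N where "B = tm_block j True" and "D = tm_gap j" and "E = tm_gap (Suc j)"
    and "N = (of_int (int n) :: bool ncseries)"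
  have E: "E = D * B - B * D" by (simp add: E_def D_def B_def tm_gap_Suc)
  have vE: "vanishes (Suc (Suc j)) E" by (simp add: E_def vanishes_tm_gap)
  have "D * B ^ Suc n - B ^ Suc n * D - (N + 1) * E
      = (D * B ^ n - B ^ n * D - N * E) * B + (B ^ n - 1) * E + N * (E * (B - 1))"
    unfolding E by (simp add: algebra_simps power_commutes flip: mult.assoc)
       (simp add: algebra_simps power_commutes)
  moreover have "vanishes (Suc (Suc (Suc j))) ((B ^ n - 1) * E)"
    "vanishes (Suc (Suc (Suc j))) (N * (E * (B - 1)))"
    by (intro vanishes_mult_left vanishes_mult_minus_1 vE; simp add: B_def)+
  moreover have "vanishes (j + 3) ((D * B ^ n - B ^ n * D - N * E) * B)"
    by (rule vanishes_mult_right) (use Suc in \<open>simp add: B_def D_def E_def N_def\<close>)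
  ultimately have "vanishes (j + 3) (D * B ^ Suc n - B ^ Suc n * D - (N + 1) * E)"
    by (simp add: vanishes_add eval_nat_numeral)
  then show ?case by (simp add: B_def D_def E_def N_def add.commute)
qed simp

text \<open>Terms with a single \<open>D\<close> are normalised by moving \<open>D\<close> to the
  right end, which costs one \<open>tm_gap (Suc j)\<close> per block crossed. Terms with two
  \<open>D\<close> have order at least \<open>2 * j + 2\<close>, which reaches \<open>j + 3\<close>
  because \<open>j > 0\<close>.\<close>

lemma magnus_tm_power_order2:
  assumes "j > 0"
  shows "vanishes (j + 3) (magnus ((tm_morphism ^^ j) w) -
     (tm_block j True ^ length w
      + of_int (int (count_list w False)) * (tm_block j True ^ (length w - 1) * tm_gap j)
      + of_int (int (zero_weight w)) * tm_gap (Suc j)))"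
proof (induction w)
  case (Cons a w)
  define B D E n N P where "B = tm_block j True" and "D = tm_gap j" and "E = tm_gap (Suc j)"
    and "n = length w"
    and "N = (of_int (int (count_list w False)) :: bool ncseries)"
    and "P = (of_int (int (zero_weight w)) :: bool ncseries)"
  define r where
    "r = magnus ((tm_morphism ^^ j) w) - (B ^ n + N * (B ^ (n - 1) * D) + P * E)"
  have r: "vanishes (j + 3) r"
    using Cons.IH by (simp only: r_def B_def D_def E_def n_def N_def P_def)
  have w: "magnus ((tm_morphism ^^ j) w) = B ^ n + N * (B ^ (n - 1) * D) + P * E + r"
    by (simp add: r_def)
  have D: "vanishes (Suc j) D" and E: "vanishes (Suc (Suc j)) E"
    by (simp_all add: D_def E_def vanishes_tm_gap)
  have NB: "N * f = f * N" "P * f = f * P" for f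
    unfolding N_def P_def by (rule mult_of_int_commute)+
  have com: "f * (N * g) = N * (f * g)" "f * (P * g) = P * (f * g)" for f g
    by (metis NB mult.assoc)+
  \<comment> \<open>For empty \<open>w\<close> the exponent \<open>n - 1\<close> is truncated, but
    then \<open>N = 0\<close>.\<close>
  have NB1: "N * (B * (B ^ (n - 1) * D)) = N * (B ^ n * D)"
  proof (cases w)
    case Nil
    then show ?thesis by (simp add: N_def)
  next
    case (Cons b v)
    then show ?thesis by (simp add: n_def mult.assoc)
  qed
  have 1: "vanishes (j + 3) (P * ((B - 1) * E))"
    using vanishes_mult_minus_1(1)[OF E, of B]
    by (intro vanishes_mult_left[of _ _ P]) (simp add: B_def eval_nat_numeral)
  have 2: "vanishes (j + 3) (D * B ^ n - B ^ n * D - of_int (int n) * E)"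
    unfolding B_def D_def E_def by (rule tm_gap_power_commute)
  have 3: "vanishes (j + 3) (N * (D * (B ^ (n - 1) * D)))"
    by (intro vanishes_mult_left vanishes_mono[OF vanishes_mult[OF D vanishes_mult_left[OF D]]])
      (use assms in simp)
  have 4: "vanishes (j + 3) (P * (D * E))"
    by (intro vanishes_mult_left vanishes_mono[OF vanishes_mult[OF D E]]) simp
  show ?case
  proof (cases a)
    case True
    have "magnus ((tm_morphism ^^ j) (a # w)) - (B ^ Suc n + N * (B ^ n * D) + P * E)
        = B * r + P * ((B - 1) * E)"
      unfolding magnus_tm_power_Cons w using True
      by (simp add: B_def[symmetric] algebra_simps com NB1[unfolded One_nat_def])
    then show ?thesis
      using True r 1
      by (simp add: B_def D_def E_def n_def N_def P_def vanishes_add vanishes_mult_left)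
  next
    case False
    have "magnus ((tm_morphism ^^ j) (a # w))
          - (B ^ Suc n + (N + 1) * (B ^ n * D) + (P + of_int (int n)) * E)
        = (B + D) * r + P * ((B - 1) * E) + (D * B ^ n - B ^ n * D - of_int (int n) * E)
          + N * (D * (B ^ (n - 1) * D)) + P * (D * E)"
      unfolding magnus_tm_power_Cons w using False
      by (simp add: tm_block_False B_def[symmetric] D_def[symmetric] algebra_simps com NB1[unfolded One_nat_def])
    then have "vanishes (j + 3) (magnus ((tm_morphism ^^ j) (a # w))
          - (B ^ Suc n + (N + 1) * (B ^ n * D) + (P + of_int (int n)) * E))"
      using r 1 2 3 4 by (simp add: vanishes_add vanishes_mult_left)
    then show ?thesis
      using False by (simp add: B_def D_def E_def n_def N_def P_def add_ac)
  qed
qed simp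

lemma word_binomial_empty [simp]: "word_binomial u [] = 1"
  by (induction u) (simp_all add: word_binomial_Nil word_binomial_Cons)

lemma word_binomial_letters: "word_binomial w [False] + word_binomial w [True] = length w"
  by (induction w) (auto simp: word_binomial_Nil word_binomial_Cons)

text \<open>A zero with a later letter is an occurrence of 00 or 01. This replaces the second-order
  expansion when \<open>j = 0\<close>.\<close>

lemma zero_weight_word_binomial:
  "zero_weight w = word_binomial w [False, False] + word_binomial w [False, True]"
proof (induction w)
  case (Cons a w)
  then show ?case using word_binomial_letters[of w] by (simp add: word_binomial_Cons)
qed (simp add: word_binomial_Nil)

text \<open>Once the numbers of zeros agree, the second-order expansions differ only by a multiple
  of \<open>tm_gap (Suc j)\<close>, whose order is exactly \<open>j + 2\<close>.\<close>

lemma binomial_equiv_tm_powerD: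
  assumes "length w = length w'"
    and eq: "((tm_morphism ^^ j) w, (tm_morphism ^^ j) w') \<in> binomial_equiv (Suc (Suc j))"
  shows "count_list w False = count_list w' False" "zero_weight w = zero_weight w'"
proof -
  show cnt: "count_list w False = count_list w' False"
    using binomial_equiv_tm_power_iff[OF assms(1), of j] binomial_equiv_mono[OF eq, of "Suc j"]
    by simp
  show "zero_weight w = zero_weight w'"
  proof (cases "j = 0")
    case True
    then have "word_binomial w x = word_binomial w' x" if "length x \<le> 2" for x
      using eq that by (simp add: binomial_equiv_def)
    then show ?thesis by (simp add: zero_weight_word_binomial)
  next
    case False
    define c where "c = int (zero_weight w) - int (zero_weight w')"
    define F where "F = magnus ((tm_morphism ^^ j) w) - magnus ((tm_morphism ^^ j) w')"
    have F: "vanishes (j + 3) F"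
      using eq by (simp add: binomial_equiv_iff_magnus F_def eval_nat_numeral)
    have v: "vanishes (j + 3) (F - of_int c * tm_gap (Suc j))"
      using vanishes_diff[OF magnus_tm_power_order2[of j w] magnus_tm_power_order2[of j w']]
        assms(1) False cnt
      by (simp add: F_def c_def algebra_simps)
    have "vanishes (j + 3) (of_int c * tm_gap (Suc j))"
      using vanishes_diff[OF F v] by simp
    then have "nc_coeff (of_int c * tm_gap (Suc j)) (False # replicate (Suc j) True) = 0"
      unfolding vanishes_def by (elim allE impE) simp_all
    then have "c = 0" using tm_gap_coeff_pos[of "Suc j"] by (simp only: nc_coeff_of_int_mult) simp
    then show ?thesis by (simp add: c_def)
  qed
qed

section \<open>Factors of the Thue--Morse word\<close>

lemma thue_morse_double [simp]:
  "thue_morse (2 * h) = thue_morse h"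
  "thue_morse (Suc (2 * h)) = (\<not> thue_morse h)"
  using fun_cong[OF thue_morse_fixed_point(1), of "2 * h"]
    fun_cong[OF thue_morse_fixed_point(1), of "Suc (2 * h)"]
  by (cases "thue_morse h"; simp add: tm_morphism_inf_def)+

text \<open>The letter is the parity of the binary digit sum, and the digits of
  \<open>2 ^ j * h\<close> and \<open>r\<close> do not overlap.\<close>

lemma thue_morse_scale:
  "r < 2 ^ j \<Longrightarrow> thue_morse (2 ^ j * h + r) = (thue_morse h \<noteq> thue_morse r)"
proof (induction j arbitrary: r)
  case 0
  then show ?case by (simp add: thue_morse_fixed_point(2))
next
  case (Suc j)
  have IH: "thue_morse (2 ^ j * h + r div 2) = (thue_morse h \<noteq> thue_morse (r div 2))"
    using Suc.prems by (intro Suc.IH) simp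
  show ?case
  proof (cases "even r")
    case True
    then obtain s where "r = 2 * s" by blast
    then have "2 ^ Suc j * h + r = 2 * (2 ^ j * h + s)" "r = 2 * s" by simp_all
    then show ?thesis using IH by (metis nonzero_mult_div_cancel_left thue_morse_double(1) zero_neq_numeral)
  next
    case False
    then obtain s where s: "r = Suc (2 * s)" by (metis oddE Suc_eq_plus1)
    then have "2 ^ Suc j * h + r = Suc (2 * (2 ^ j * h + s))" by simp
    then have "thue_morse (2 ^ Suc j * h + r) = (\<not> thue_morse (2 ^ j * h + s))"
      by (metis thue_morse_double(2))
    then show ?thesis using IH s by simp
  qed
qed

lemma tm_power_segment:
  "(tm_morphism ^^ j) (map thue_morse [a..<b]) = map thue_morse [2 ^ j * a..<2 ^ j * b]"
proof (induction j arbitrary: a b)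
  case (Suc j)
  have "tm_morphism (map thue_morse [a..<b]) = map thue_morse [2 * a..<2 * b]" for a b
    by (induction b) auto
  then show ?case using Suc by (simp add: mult.assoc)
qed simp

text \<open>Three consecutive positions contain a pair \<open>2 * s\<close>,
  \<open>Suc (2 * s)\<close>, whose letters differ.\<close>

lemma thue_morse_no_cube:
  "\<not> (thue_morse g = thue_morse (Suc g) \<and> thue_morse (Suc g) = thue_morse (Suc (Suc g)))"
proof (cases "even g")
  case True
  then obtain s where "g = 2 * s" by blast
  then show ?thesis by simp
next
  case False
  then obtain s where "g = Suc (2 * s)" by (metis oddE Suc_eq_plus1)
  moreover have "thue_morse (Suc (Suc (2 * s))) = thue_morse (Suc s)"
    "thue_morse (Suc (Suc (Suc (2 * s)))) = (\<not> thue_morse (Suc s))"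
    using thue_morse_double[of "Suc s"] by simp_all
  ultimately show ?thesis by simp
qed

text \<open>If the parities differed, block pairs of both alignments would make the letters
  alternate; undoing the morphism, the letters at \<open>g\<close>, \<open>g + 1\<close> and
  \<open>g + 2\<close> would then be equal.\<close>

lemma even_if_five_letters:
  assumes eq: "\<And>i. i < 5 \<Longrightarrow> thue_morse (h + i) = thue_morse (h' + i)" and h: "odd h"
  shows "odd h'"
proof
  assume "even h'"
  with h obtain g g' where g: "h = Suc (2 * g)" "h' = 2 * g'" by (metis oddE evenE Suc_eq_plus1)
  have t: "thue_morse (Suc (Suc (2 * s))) = thue_morse (Suc s)"
    "thue_morse (Suc (Suc (Suc (2 * s)))) = (\<not> thue_morse (Suc s))"
    "thue_morse (Suc (Suc (Suc (Suc (2 * s))))) = thue_morse (Suc (Suc s))"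
    for s
    using thue_morse_double[of "Suc s"] thue_morse_double[of "Suc (Suc s)"] by simp_all
  show False
    using eq[of 0] eq[of "Suc 0"] eq[of "Suc (Suc 0)"] eq[of "Suc (Suc (Suc 0))"]
      thue_morse_no_cube[of g] by (simp add: g t)
qed

section \<open>Partial sums of the sign sequence\<close>

definition tm_sign :: "nat \<Rightarrow> int" where
  "tm_sign h = (if thue_morse h then - 1 else 1)"

definition tm_sum :: "nat \<Rightarrow> int" where
  "tm_sum h = (\<Sum>i<h. tm_sign i)"

lemma tm_sign_cases: "tm_sign h = 1 \<or> tm_sign h = - 1"
  by (simp add: tm_sign_def)

lemma tm_sign_eq_iff: "tm_sign h = tm_sign h' \<longleftrightarrow> thue_morse h = thue_morse h'"
  by (simp add: tm_sign_def)

lemma tm_sign_double [simp]: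
  "tm_sign (2 * h) = tm_sign h" "tm_sign (Suc (2 * h)) = - tm_sign h"
  by (simp_all add: tm_sign_def)

lemma tm_sum_Suc: "tm_sum (Suc h) = tm_sum h + tm_sign h"
  by (simp add: tm_sum_def)

lemma tm_sum_double [simp]: "tm_sum (2 * h) = 0" "tm_sum (Suc (2 * h)) = tm_sign h"
proof -
  show "tm_sum (2 * h) = 0"
    by (induction h) (simp_all add: tm_sum_Suc, simp add: tm_sum_def)
  then show "tm_sum (Suc (2 * h)) = tm_sign h" by (simp add: tm_sum_Suc)
qed

lemma tm_sum_even: "even h \<Longrightarrow> tm_sum h = 0"
  and tm_sum_odd: "odd h \<Longrightarrow> tm_sum h = tm_sign (h div 2)"
  by (auto elim!: evenE oddE)

lemma tm_sum_bound: "tm_sum h \<le> 1" "- 1 \<le> tm_sum h"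
  using tm_sum_even[of h] tm_sum_odd[of h] tm_sign_cases[of "h div 2"]
  by (cases "even h"; auto)+

text \<open>For even \<open>h\<close> nothing changes and \<open>tm_sum h = 0\<close>; for odd
  \<open>h\<close> the half grows by one, adding \<open>tm_sign (h div 2)\<close>, which is
  \<open>tm_sum h\<close>.\<close>

lemma tm_sum_half_Suc: "tm_sum (Suc h div 2) = tm_sum (h div 2) + tm_sum h"
  by (cases "even h") (auto elim!: evenE oddE simp: tm_sum_Suc)

lemma count_segment:
  "2 * int (count_list (map thue_morse [a..<a + m]) False) = int m + tm_sum (a + m) - tm_sum a"
  by (induction m) (auto simp: tm_sum_Suc tm_sign_def)

text \<open>The weighted sum of the signs is a sum of partial sums \<^const>\<open>tm_sum\<close>, and by
  \<open>tm_sum_half_Suc\<close> the sum of \<^term>\<open>tm_sum i\<close> over \<open>i < h\<close> is again a partial sum, \<^term>\<open>tm_sum (h div 2)\<close>.\<close>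

lemma zero_weight_segment:
  "4 * int (zero_weight (map thue_morse [a..<a + m])) = int m * (int m - 1)
     + 2 * (tm_sum ((a + m) div 2) - tm_sum (a div 2) - int m * tm_sum a)"
proof (induction m arbitrary: a)
  case (Suc m)
  have "[a..<a + Suc m] = a # [Suc a..<Suc a + m]" by (simp add: upt_conv_Cons)
  then have "4 * int (zero_weight (map thue_morse [a..<a + Suc m]))
      = 4 * int (zero_weight (map thue_morse [Suc a..<Suc a + m])) + 2 * int m * (1 + tm_sign a)"
    by (simp add: tm_sign_def)
  then show ?case
    unfolding Suc.IH by (simp add: tm_sum_half_Suc[of a] tm_sum_Suc algebra_simps)
qed simp

text \<open>In the second equation \<open>int m * tm_sum h'\<close> has absolute value
  \<open>m\<close>, while the four other partial sums that remain are bounded by 1. This excludes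
  \<open>m \<ge> 5\<close>; for even \<open>m\<close> the first equation sharpens the bound to 3 and
  so excludes 4 as well.\<close>

lemma balance_parity:
  assumes "m \<ge> 4" "even h" "odd h'"
    and 1: "tm_sum (h + m) - tm_sum h = tm_sum (h' + m) - tm_sum h'"
    and 2: "tm_sum ((h + m) div 2) - tm_sum (h div 2) - int m * tm_sum h
      = tm_sum ((h' + m) div 2) - tm_sum (h' div 2) - int m * tm_sum h'"
  shows False
proof -
  have h: "tm_sum h = 0" "tm_sum h' = 1 \<or> tm_sum h' = - 1"
    using assms tm_sign_cases[of "h' div 2"] by (simp_all add: tm_sum_even tm_sum_odd)
  note b = tm_sum_bound[of "(h + m) div 2"] tm_sum_bound[of "h div 2"]
    tm_sum_bound[of "(h' + m) div 2"] tm_sum_bound[of "h' div 2"]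
  show False
  proof (cases "even m")
    case True
    define H where "H = (h' + m) div 2"
    have "tm_sign H = tm_sum h'"
      using 1 assms True h by (simp add: tm_sum_even tm_sum_odd H_def)
    \<comment> \<open>A nonzero \<open>tm_sum H\<close> is the sign of the first letter of a block
      whose second letter is at \<open>H\<close>, hence opposite to
      \<open>tm_sign H\<close>.\<close>
    moreover have "tm_sum H = 0 \<or> tm_sum H = - tm_sign H"
      by (cases "even H") (auto elim!: evenE oddE)
    ultimately have "tm_sum H * tm_sum h' \<le> 0" using h by auto
    moreover have "int m \<ge> 4" using \<open>m \<ge> 4\<close> by simp
    ultimately show False
      using h 2 b unfolding H_def[symmetric] by (elim disjE) simp_all
  next
    case False
    then have "m \<ge> 5" using \<open>m \<ge> 4\<close> by (cases "m = 4") auto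
    then have "int m \<ge> 5" by simp
    then show False using h 2 b by (elim disjE) simp_all
  qed
qed

text \<open>With equal parities \<open>tm_sum h\<close> and \<open>tm_sum h'\<close> differ by an
  even number. A nonzero difference, multiplied by \<open>m\<close>, would be at least 8 in absolute
  value, against four terms bounded by 1. The letters are then read off from the partial sums at odd
  arguments.\<close>

lemma balance:
  assumes "m \<ge> 4"
    and 1: "tm_sum (h + m) - tm_sum h = tm_sum (h' + m) - tm_sum h'"
    and 2: "tm_sum ((h + m) div 2) - tm_sum (h div 2) - int m * tm_sum h
      = tm_sum ((h' + m) div 2) - tm_sum (h' div 2) - int m * tm_sum h'"
  shows "even h = even h'"
    and "odd h \<Longrightarrow> thue_morse (h div 2) = thue_morse (h' div 2)"
    and "odd (h + m) \<Longrightarrow> thue_morse ((h + m) div 2) = thue_morse ((h' + m) div 2)"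
proof -
  show par: "even h = even h'"
    using balance_parity[of m h h'] balance_parity[of m h' h] assms by metis
  have T: "tm_sum h = tm_sum h'"
  proof (rule ccontr)
    assume "tm_sum h \<noteq> tm_sum h'"
    then have "tm_sum h - tm_sum h' \<le> - 2 \<or> tm_sum h - tm_sum h' \<ge> 2"
      using par tm_sum_even[of h] tm_sum_even[of h'] tm_sum_odd[of h] tm_sum_odd[of h']
        tm_sign_cases[of "h div 2"] tm_sign_cases[of "h' div 2"]
      by (cases "even h") auto
    then have "int m * (tm_sum h - tm_sum h') \<le> int m * - 2
        \<or> int m * (tm_sum h - tm_sum h') \<ge> int m * 2"
      by (meson mult_left_mono of_nat_0_le_iff)
    moreover have "int m * (tm_sum h - tm_sum h') = tm_sum ((h + m) div 2) - tm_sum (h div 2)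
        - tm_sum ((h' + m) div 2) + tm_sum (h' div 2)"
      using 2 by (simp add: algebra_simps)
    ultimately show False
      using \<open>m \<ge> 4\<close> tm_sum_bound[of "(h + m) div 2"] tm_sum_bound[of "h div 2"]
        tm_sum_bound[of "(h' + m) div 2"] tm_sum_bound[of "h' div 2"] by linarith
  qed
  show "thue_morse (h div 2) = thue_morse (h' div 2)" if "odd h"
    using T par that by (simp add: tm_sum_odd tm_sign_eq_iff)
  show "thue_morse ((h + m) div 2) = thue_morse ((h' + m) div 2)" if "odd (h + m)"
  proof -
    have "odd (h' + m)" using that par by simp
    moreover have "tm_sum (h + m) = tm_sum (h' + m)" using T 1 by simp
    ultimately show ?thesis using that by (metis tm_sum_odd tm_sign_eq_iff)
  qed
qed

text \<open>Up to length 3 one of the letters occurs at most once, and its position is determined by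
  the weight. At length 4 the words 0110 and 1001 have the same statistics.\<close>

lemma short_words_eq:
  assumes "length w = length w'" "length w \<le> 3"
    and "count_list w False = count_list w' False" "zero_weight w = zero_weight w'"
  shows "w = w'"
proof -
  have short: "v = [] \<or> (\<exists>a. v = [a]) \<or> (\<exists>a b. v = [a, b]) \<or> (\<exists>a b c. v = [a, b, c])"
    if "length v \<le> 3" for v :: "bool list"
    using that by (cases v; cases "tl v"; cases "tl (tl v)") auto
  show ?thesis
    using short[OF assms(2)] short[OF assms(2)[unfolded assms(1)]] assms
    by (elim disjE exE) (simp_all split: if_splits)
qed

section \<open>Cutting factors into blocks\<close>

abbreviation tm_factor :: "nat \<Rightarrow> nat \<Rightarrow> bool list" where
  "tm_factor n i \<equiv> map thue_morse [i..<i + n]"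

text \<open>A start inside a block moves the first boundary to the next block, whence
  \<open>of_bool (r \<noteq> 0)\<close>; the bound on \<open>n\<close> keeps this boundary at or
  before the last one.\<close>

lemma tm_factor_split:
  assumes "r < 2 ^ j" "2 ^ j \<le> n"
  shows "tm_factor n (2 ^ j * h + r) =
      map thue_morse [2 ^ j * h + r..<2 ^ j * (h + of_bool (r \<noteq> 0))]
      @ (tm_morphism ^^ j) (map thue_morse [h + of_bool (r \<noteq> 0)..<h + (r + n) div 2 ^ j])
      @ map thue_morse [2 ^ j * (h + (r + n) div 2 ^ j)..<2 ^ j * h + r + n]"
proof -
  define q L :: nat where "q = 2 ^ j" and "L = (r + n) div q"
  have q: "q > 0" "r < q" "q \<le> n" using assms by (simp_all add: q_def)
  have "of_bool (r \<noteq> 0) \<le> L"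
    using q by (simp add: L_def of_bool_def div_greater_zero_iff Suc_le_eq)
  then have "q * (h + of_bool (r \<noteq> 0)) \<le> q * (h + L)" by simp
  moreover have "q * h + r \<le> q * (h + of_bool (r \<noteq> 0))" using q by (simp add: algebra_simps)
  moreover have "q * L \<le> r + n" unfolding L_def by simp
  then have "q * (h + L) \<le> q * h + r + n" by (simp add: algebra_simps)
  moreover have upt: "[a..<c] = [a..<b] @ [b..<c]" if "a \<le> b" "b \<le> c" for a b c
    using upt_add_eq_append[OF that(1), of "c - b"] that(2) by simp
  ultimately have "[q * h + r..<q * h + r + n] = [q * h + r..<q * (h + of_bool (r \<noteq> 0))]
      @ [q * (h + of_bool (r \<noteq> 0))..<q * (h + L)] @ [q * (h + L)..<q * h + r + n]"
    by (metis le_trans)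
  then show ?thesis by (simp add: tm_power_segment q_def L_def)
qed

text \<open>By \<open>thue_morse_scale\<close>, a piece of a block depends only on its place in the
  block and on the preimage letter; at an aligned end the piece is empty.\<close>

lemma frame_cancel:
  assumes r: "r < 2 ^ j" and n: "2 ^ j \<le> n"
    and l: "r \<noteq> 0 \<Longrightarrow> thue_morse h = thue_morse h'"
    and e: "(r + n) mod 2 ^ j \<noteq> 0 \<Longrightarrow>
      thue_morse (h + (r + n) div 2 ^ j) = thue_morse (h' + (r + n) div 2 ^ j)"
  obtains p s where "\<And>g. g = h \<or> g = h' \<Longrightarrow> tm_factor n (2 ^ j * g + r) =
     p @ (tm_morphism ^^ j) (map thue_morse [g + of_bool (r \<noteq> 0)..<g + (r + n) div 2 ^ j]) @ s"
proof -
  let ?p = "\<lambda>h. map thue_morse [2 ^ j * h + r..<2 ^ j * (h + of_bool (r \<noteq> 0))]"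
  let ?s = "\<lambda>h. map thue_morse [2 ^ j * (h + (r + n) div 2 ^ j)..<2 ^ j * h + r + n]"
  have "?p h = ?p h'"
  proof (cases "r = 0")
    case False
    have "thue_morse (2 ^ j * h + (r + i)) = thue_morse (2 ^ j * h' + (r + i))" if "i < 2 ^ j - r" for i
      using that l False by (simp add: thue_morse_scale)
    then show ?thesis using False by (intro nth_equalityI) (simp_all add: add.assoc)
  qed simp
  moreover have "?s h = ?s h'"
  proof -
    define L q where "L = (r + n) div 2 ^ j" and "q = (2 ^ j :: nat)"
    define rho where "rho = (r + n) mod q"
    have rn: "r + n = q * L + rho" by (simp add: L_def q_def rho_def)
    have end_pos: "2 ^ j * g + r + n = q * (g + L) + rho" for g
      using rn by (simp add: q_def algebra_simps)
    have "thue_morse (q * (h + L) + i) = thue_morse (q * (h' + L) + i)" if "i < rho" for i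
    proof -
      have "i < 2 ^ j" using that mod_less_divisor[of q "r + n"] by (simp add: rho_def q_def del: mod_less_divisor)
      then show ?thesis
        using that e thue_morse_scale[of i j] unfolding q_def L_def rho_def by auto
    qed
    then show ?thesis
      unfolding end_pos by (intro nth_equalityI) (simp_all add: L_def q_def)
  qed
  ultimately show thesis
    using tm_factor_split[OF r n, of h] tm_factor_split[OF r n, of h'] that[of "?p h" "?s h"] by metis
qed

text \<open>In a factor of length \<open>n\<close> starting at \<open>i\<close>, the block of length \<open>2\<^sup>j\<close> containing the left end is
  cut iff \<open>i mod 2\<^sup>j \<noteq> 0\<close>, and the one containing the right end iff \<open>(i + n) mod 2\<^sup>j \<noteq> 0\<close>. Only then
  does the preimage letter of that block matter.\<close>

definition same_frame :: "nat \<Rightarrow> nat \<Rightarrow> nat \<Rightarrow> nat \<Rightarrow> bool" where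
  "same_frame j n i i' \<longleftrightarrow> i mod 2 ^ j = i' mod 2 ^ j
     \<and> (i mod 2 ^ j \<noteq> 0 \<longrightarrow> thue_morse (i div 2 ^ j) = thue_morse (i' div 2 ^ j))
     \<and> ((i + n) mod 2 ^ j \<noteq> 0 \<longrightarrow>
          thue_morse ((i + n) div 2 ^ j) = thue_morse ((i' + n) div 2 ^ j))"

definition inner_word :: "nat \<Rightarrow> nat \<Rightarrow> nat \<Rightarrow> bool list" where
  "inner_word j n i = map thue_morse
     [i div 2 ^ j + of_bool (i mod 2 ^ j \<noteq> 0)..<i div 2 ^ j + (i mod 2 ^ j + n) div 2 ^ j]"

lemma add_div_split: "(i + n) div q = i div q + (i mod q + n) div q" for i n q :: nat
proof (cases "q = 0")
  case False
  have "i + n = (i mod q + n) + q * (i div q)" by simp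
  then show ?thesis using False by (metis div_mult_self2 add.commute)
qed simp

lemma same_frameE:
  assumes fr: "same_frame j n i i'" and n: "2 ^ j \<le> n"
  obtains p s where "tm_factor n i = p @ (tm_morphism ^^ j) (inner_word j n i) @ s"
    and "tm_factor n i' = p @ (tm_morphism ^^ j) (inner_word j n i') @ s"
proof -
  define r where "r = i mod 2 ^ j"
  have i': "i' mod 2 ^ j = r" using fr by (simp add: same_frame_def r_def)
  have r: "r < 2 ^ j" by (simp add: r_def)
  obtain p s where ps: "\<And>g. g = i div 2 ^ j \<or> g = i' div 2 ^ j \<Longrightarrow>
      tm_factor n (2 ^ j * g + r) =
      p @ (tm_morphism ^^ j) (map thue_morse [g + of_bool (r \<noteq> 0)..<g + (r + n) div 2 ^ j]) @ s"
  proof (rule frame_cancel[OF r n, of "i div 2 ^ j" "i' div 2 ^ j"])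
    show "thue_morse (i div 2 ^ j) = thue_morse (i' div 2 ^ j)" if "r \<noteq> 0"
      using fr that by (simp add: same_frame_def r_def)
    show "thue_morse (i div 2 ^ j + (r + n) div 2 ^ j) = thue_morse (i' div 2 ^ j + (r + n) div 2 ^ j)"
      if "(r + n) mod 2 ^ j \<noteq> 0"
    proof -
      have "(i + n) mod 2 ^ j \<noteq> 0" using that by (simp add: r_def mod_simps)
      then show ?thesis
        using fr add_div_split[of i n "2 ^ j"] add_div_split[of i' n "2 ^ j"] i'
        by (simp add: same_frame_def r_def)
    qed
  qed blast
  have "2 ^ j * (i div 2 ^ j) + r = i" "2 ^ j * (i' div 2 ^ j) + r = i'"
    by (simp add: r_def) (metis i' mult_div_mod_eq)
  then show thesis
    using that[of p s] ps[of "i div 2 ^ j"] ps[of "i' div 2 ^ j"] i' by (simp add: inner_word_def r_def)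
qed

lemma length_inner_word:
  "same_frame j n i i' \<Longrightarrow> length (inner_word j n i) = length (inner_word j n i')"
  by (simp add: inner_word_def same_frame_def)

lemma same_frame_binomial_equiv_iff:
  assumes fr: "same_frame j n i i'" and n: "2 ^ j \<le> n"
  shows "(tm_factor n i, tm_factor n i') \<in> binomial_equiv k \<longleftrightarrow>
    ((tm_morphism ^^ j) (inner_word j n i), (tm_morphism ^^ j) (inner_word j n i')) \<in> binomial_equiv k"
  by (rule same_frameE[OF fr n]) (simp add: binomial_equiv_cancel)

text \<open>Cancelling the partial blocks leaves inner words with equal number of zeros and equal
  weight. \<open>balance\<close> then gives the parity of the block index, which is the next binary
  digit of the offset, and the letters at newly cut ends.\<close>

lemma same_frame_step:
  assumes fr: "same_frame j n i i'" and n: "2 ^ Suc (Suc j) \<le> n"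
    and eq: "(tm_factor n i, tm_factor n i') \<in> binomial_equiv (Suc (Suc j))"
  shows "same_frame (Suc j) n i i'"
proof -
  define q h h' r L \<rho> d m :: nat where "q = 2 ^ j" and "h = i div q" and "h' = i' div q"
    and "r = i mod q" and "L = (r + n) div q" and "\<rho> = (r + n) mod q"
    and "d = of_bool (r \<noteq> 0)" and "m = L - d"
  have q: "q > 0" "4 * q \<le> n" using n by (simp_all add: q_def)
  have r': "i' mod q = r" using fr by (simp add: same_frame_def r_def q_def)
  have r: "r < q" using q by (simp add: r_def)
  have rn: "r + n = q * L + \<rho>" by (simp add: L_def \<rho>_def)
  have endd: "(i + n) div q = h + L" "(i' + n) div q = h' + L"
    unfolding h_def h'_def L_def r_def using add_div_split[of i n q] add_div_split[of i' n q] r'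
    by (simp_all add: r_def)
  have endm: "(i + n) mod q = \<rho>" "(i' + n) mod q = \<rho>"
    unfolding \<rho>_def by (metis mod_add_left_eq r_def) (metis mod_add_left_eq r')
  have lh: "thue_morse h = thue_morse h'" if "r \<noteq> 0"
    using fr that by (simp add: same_frame_def r_def h_def h'_def q_def)
  have le: "thue_morse (h + L) = thue_morse (h' + L)" if "\<rho> \<noteq> 0"
    using fr that endd endm by (simp add: same_frame_def q_def)
  have L4: "4 \<le> L"
    using q by (simp add: L_def less_eq_div_iff_mult_less_eq)
  then have L: "L = d + m" by (simp add: m_def d_def of_bool_def)
  \<comment> \<open>If only the left end is cut, then \<open>q * L = r + n > 4 * q\<close>, so
    discarding the first block still leaves four.\<close>
  have m4: "m \<ge> 4" if "r = 0 \<or> \<rho> = 0"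
  proof (cases "r = 0")
    case False
    then have "q * 4 < q * L" using that rn q by linarith
    then show ?thesis using L False by (simp add: d_def)
  qed (use L L4 d_def in simp)
  have inner_word: "inner_word j n i = tm_factor m (h + d)" "inner_word j n i' = tm_factor m (h' + d)"
    unfolding inner_word_def q_def[symmetric] h_def[symmetric] h'_def[symmetric] r' r_def[symmetric]
      L_def[symmetric] d_def[symmetric] by (simp_all add: L add.assoc)
  have len: "length (inner_word j n i) = length (inner_word j n i')" by (simp add: inner_word)
  have "2 ^ j \<le> n" using q by (simp add: q_def)
  then have eq': "((tm_morphism ^^ j) (inner_word j n i), (tm_morphism ^^ j) (inner_word j n i'))
      \<in> binomial_equiv (Suc (Suc j))"
    using same_frame_binomial_equiv_iff[OF fr] eq by blast
  note cw = binomial_equiv_tm_powerD[OF len eq']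
  have 1: "tm_sum (h + d + m) - tm_sum (h + d) = tm_sum (h' + d + m) - tm_sum (h' + d)"
    using cw(1) count_segment[of "h + d" m] count_segment[of "h' + d" m] by (simp add: inner_word)
  have 2: "tm_sum ((h + d + m) div 2) - tm_sum ((h + d) div 2) - int m * tm_sum (h + d)
      = tm_sum ((h' + d + m) div 2) - tm_sum ((h' + d) div 2) - int m * tm_sum (h' + d)"
    using cw(2) zero_weight_segment[of "h + d" m] zero_weight_segment[of "h' + d" m]
    by (simp add: inner_word)
  have par: "even h = even h'"
  proof (cases "m \<ge> 4")
    case True
    then show ?thesis using balance(1)[OF True 1 2] by (auto simp: even_add)
  next
    case False
    then have "\<not> (r = 0 \<or> \<rho> = 0)" using m4 by blast
    then have nz: "r \<noteq> 0" "\<rho> \<noteq> 0" by simp_all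
    then have L_eq: "d = 1" "m = 3" "L = 4" using False L L4 by (simp_all add: d_def)
    \<comment> \<open>The case \<open>m = 3\<close> occurs only with both ends cut: the equal inner
      words and the two letters of the frame make five equal consecutive letters.\<close>
    then have "tm_factor 3 (h + 1) = tm_factor 3 (h' + 1)"
      using short_words_eq[OF len _ cw] by (simp add: inner_word)
    then have inn: "thue_morse (h + 1 + x) = thue_morse (h' + 1 + x)" if "x < 3" for x
      using that nth_map_upt[of x "h + 1 + 3" "h + 1" thue_morse]
        nth_map_upt[of x "h' + 1 + 3" "h' + 1" thue_morse] by (simp del: nth_map)
    have five: "thue_morse (h + x) = thue_morse (h' + x)" if "x < 5" for x
      using that lh[OF nz(1)] le[OF nz(2)] L_eq
        inn[of "x - 1"]
      by (cases "x = 0"; cases "x = 4") auto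
    show ?thesis
      using even_if_five_letters[of h h'] even_if_five_letters[of h' h] five by metis
  qed
  have div2: "thue_morse (a div 2) = thue_morse (b div 2)"
    if "even a = even b" "thue_morse a = thue_morse b" for a b
    using that by (cases "even a") (auto elim!: evenE oddE)
  \<comment> \<open>The condition says that the left end cuts a block of length
    \<open>2 * q\<close>. If it already cut a block of length \<open>q\<close>, the known letter and
    the parity of \<open>h\<close> give the preimage letter.\<close>
  have start_letter: "thue_morse (h div 2) = thue_morse (h' div 2)" if "r \<noteq> 0 \<or> odd h"
  proof (cases "r = 0")
    case True
    then show ?thesis using balance(2)[OF m4 1 2] that by (simp add: d_def)
  qed (use div2 par lh in blast)
  have end_letter: "thue_morse ((h + L) div 2) = thue_morse ((h' + L) div 2)" if "\<rho> \<noteq> 0 \<or> odd (h + L)"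
  proof (cases "\<rho> = 0")
    case True
    then show ?thesis using balance(3)[OF m4 1 2] that by (simp add: L add.assoc)
  next
    case False
    then show ?thesis using le par by (intro div2) simp_all
  qed
  have scale: "x mod 2 ^ Suc j = q * (x div q mod 2) + x mod q" "x div 2 ^ Suc j = x div q div 2" for x
    by (simp_all add: q_def mod_mult2_eq div_mult2_eq mult.commute[of 2])
  have hm: "h' mod 2 = h mod 2" using par by (simp add: mod2_eq_if)
  have left: "r \<noteq> 0 \<or> odd h" if "q * (h mod 2) + r \<noteq> 0"
    using that by (auto simp: mod2_eq_if split: if_splits)
  have right: "\<rho> \<noteq> 0 \<or> odd (h + L)" if "q * ((h + L) mod 2) + \<rho> \<noteq> 0"
    using that by (auto simp: mod2_eq_if split: if_splits)
  show ?thesis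
    unfolding same_frame_def scale endd endm r' h_def[symmetric] h'_def[symmetric] r_def[symmetric] hm
    by (intro conjI impI refl; erule left[THEN start_letter] right[THEN end_letter])
qed

lemma binomial_equiv_same_frame:
  "2 ^ Suc j \<le> n \<Longrightarrow> (tm_factor n i, tm_factor n i') \<in> binomial_equiv (Suc j) \<Longrightarrow> same_frame j n i i'"
proof (induction j)
  case 0
  then show ?case by (simp add: same_frame_def)
next
  case (Suc j)
  have "(tm_factor n i, tm_factor n i') \<in> binomial_equiv (Suc j)"
    using Suc.prems(2) binomial_equiv_mono by fastforce
  moreover have "2 ^ Suc j \<le> n" using Suc.prems(1) by simp
  ultimately show ?case using Suc by (intro same_frame_step) auto
qed

text \<open>When \<open>2 ^ k \<le> n < 2 ^ Suc k\<close>, the frames for blocks of length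
  \<open>2 ^ (k - 1)\<close> agree and at most three full blocks lie inside, so
  \<open>short_words_eq\<close> applies. Shorter factors fall to the induction hypothesis, and
  \<open>k = 0\<close> leaves single letters.\<close>

lemma binomial_equiv_short:
  assumes "n < 2 ^ k" and eq: "(tm_factor n i, tm_factor n i') \<in> binomial_equiv k"
  shows "tm_factor n i = tm_factor n i'"
  using assms
proof (induction k)
  case (Suc k)
  show ?case
  proof (cases "n < 2 ^ k")
    case True
    then show ?thesis using Suc binomial_equiv_mono by (metis le_SucI order_refl)
  next
    case False
    show ?thesis
    proof (cases k)
      case 0
      then have "n = 1" using False Suc.prems by simp
      then have "(((tm_morphism ^^ 0) (tm_factor n i)), ((tm_morphism ^^ 0) (tm_factor n i'))) \<in> binomial_equiv (Suc 0)"
        using Suc.prems 0 by simp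
      then show ?thesis using binomial_equiv_tm_power_iff[of "tm_factor n i" "tm_factor n i'" 0] \<open>n = 1\<close>
        by (simp split: if_splits)
    next
      case (Suc j)
      have fr: "same_frame j n i i'"
      proof (rule binomial_equiv_same_frame)
        show "(tm_factor n i, tm_factor n i') \<in> binomial_equiv (Suc j)"
          using Suc.prems(2) binomial_equiv_mono Suc by (metis le_SucI order_refl)
      qed (use False Suc in simp)
      have n: "2 ^ j \<le> n" using False Suc by simp
      have "((tm_morphism ^^ j) (inner_word j n i), (tm_morphism ^^ j) (inner_word j n i'))
          \<in> binomial_equiv (Suc (Suc j))"
        using same_frame_binomial_equiv_iff[OF fr n] Suc.prems(2) Suc by simp
      note cw = binomial_equiv_tm_powerD[OF length_inner_word[OF fr] this]
      have "length (inner_word j n i) \<le> 3"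
      proof -
        define q r where "q = (2 ^ j :: nat)" and "r = i mod q"
        have "q > 0" "r < q" "n < 4 * q" using Suc.prems(1) Suc by (simp_all add: q_def r_def)
        then have "(r + n) div q \<le> 3 + of_bool (r \<noteq> 0)"
          by (cases "r = 0") (simp_all add: div_less_iff_less_mult flip: less_Suc_eq_le)
        then show ?thesis by (simp add: inner_word_def flip: q_def r_def)
      qed
      then have "inner_word j n i = inner_word j n i'"
        using short_words_eq[OF length_inner_word[OF fr] _ cw] by simp
      then show ?thesis by (metis same_frameE[OF fr n])
    qed
  qed
qed simp

lemma binomial_equiv_iff_same_frame:
  assumes n: "2 ^ Suc j \<le> n"
  shows "(tm_factor n i, tm_factor n i') \<in> binomial_equiv (Suc j) \<longleftrightarrow>
    same_frame j n i i' \<and> count_list (inner_word j n i) False = count_list (inner_word j n i') False"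
proof (cases "same_frame j n i i'")
  case True
  have "2 ^ j \<le> n" using n by simp
  then show ?thesis
    using True same_frame_binomial_equiv_iff binomial_equiv_tm_power_iff length_inner_word by simp
next
  case False
  then show ?thesis using binomial_equiv_same_frame n by blast
qed

section \<open>Counting the classes\<close>

text \<open>Doubling positions reduces distance \<open>d\<close> to \<open>d div 2\<close>,
  complementing the second letter if \<open>d\<close> is odd. At distance 1 the positions 0, 1, 2
  and 5 show 01, 11, 10 and 00.\<close>

lemma thue_morse_pair:
  assumes "d \<ge> 1"
  shows "\<exists>g. thue_morse g = a \<and> thue_morse (g + d) = b"
  using assms
proof (induction d arbitrary: a b rule: less_induct)
  case (less d)
  define e where "e = d div 2"
  consider "d = 1" | "d = 2 * e" "e \<ge> 1" | "d = Suc (2 * e)" "e \<ge> 1"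
    using less.prems unfolding e_def by linarith
  then show ?case
  proof cases
    case 1
    have "\<not> thue_morse 0" using thue_morse_fixed_point(2) by simp
    then have "thue_morse 1" using thue_morse_double(2)[of 0] by simp
    moreover have "thue_morse 2 = thue_morse 1" "thue_morse 3 = (\<not> thue_morse 1)"
      "thue_morse 5 = (\<not> thue_morse 2)" "thue_morse 6 = thue_morse 3"
      using thue_morse_double(1)[of 1] thue_morse_double(2)[of 1] thue_morse_double(2)[of 2]
        thue_morse_double(1)[of 3] by simp_all
    ultimately have "thue_morse 0 = False \<and> thue_morse (0 + d) = True"
      "thue_morse 1 = True \<and> thue_morse (1 + d) = True"
      "thue_morse 2 = True \<and> thue_morse (2 + d) = False"
      "thue_morse 5 = False \<and> thue_morse (5 + d) = False"
      using \<open>d = 1\<close> \<open>\<not> thue_morse 0\<close> by (simp_all add: numeral_2_eq_2 numeral_3_eq_3)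
    then show ?thesis by (cases a; cases b) (simp_all only: simp_thms, blast+)
  next
    case 2
    then obtain g where "thue_morse g = a" "thue_morse (g + e) = b"
      using less.IH[of e a b] by auto
    then have "thue_morse (2 * g) = a \<and> thue_morse (2 * g + d) = b"
      using 2 thue_morse_double(1)[of "g + e"] by (simp add: distrib_left)
    then show ?thesis by blast
  next
    case 3
    then obtain g where "thue_morse g = a" "thue_morse (g + e) = (\<not> b)"
      using less.IH[of e a "\<not> b"] by auto
    then have "thue_morse (2 * g) = a \<and> thue_morse (2 * g + d) = b"
      using 3 thue_morse_double(2)[of "g + e"] by (simp add: distrib_left)
    then show ?thesis by blast
  qed
qed

lemma range_thue_morse_pair:
  assumes "d \<ge> 1"
  shows "range (\<lambda>g. F (thue_morse g) (thue_morse (g + d)))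
    = {F False False, F False True, F True False, F True True}" (is "?R = ?S")
proof
  show "?R \<subseteq> ?S"
  proof
    fix y assume "y \<in> ?R"
    then obtain g where "y = F (thue_morse g) (thue_morse (g + d))" by blast
    then show "y \<in> ?S" by (cases "thue_morse g"; cases "thue_morse (g + d)") simp_all
  qed
  have "F a b \<in> ?R" for a b
  proof -
    obtain g where "thue_morse g = a" "thue_morse (g + d) = b"
      using thue_morse_pair[OF assms] by blast
    then show ?thesis by (intro range_eqI[of _ _ g]) simp
  qed
  then show "?S \<subseteq> ?R" by blast
qed

text \<open>Halving the argument turns each code into a function of two letters at a fixed distance,
  and these letters are independent by \<open>thue_morse_pair\<close>. The distances for even and
  odd arguments may differ by a carry.\<close>

lemma range_by_parity:
  assumes "d \<ge> 1" "e \<ge> 1"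
    and "\<And>g. f (2 * g) = F (thue_morse g) (thue_morse (g + d))"
    and "\<And>g. f (Suc (2 * g)) = G (thue_morse g) (thue_morse (g + e))"
  shows "range f = {F False False, F False True, F True False, F True True}
    \<union> {G False False, G False True, G True False, G True True}"
proof -
  have "range f = range (\<lambda>g. f (2 * g)) \<union> range (\<lambda>g. f (Suc (2 * g)))"
  proof (intro equalityI subsetI)
    fix y assume "y \<in> range f"
    then obtain h where "y = f h" by blast
    then show "y \<in> range (\<lambda>g. f (2 * g)) \<union> range (\<lambda>g. f (Suc (2 * g)))"
      by (cases "even h") (auto elim!: evenE oddE)
  qed auto
  then show ?thesis
    unfolding assms(3,4) range_thue_morse_pair[OF assms(1)] range_thue_morse_pair[OF assms(2)] .
qed

lemma thue_morse_double_add [simp]: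
  "thue_morse (2 * g + 2 * d) = thue_morse (g + d)"
  "thue_morse (Suc (2 * g + 2 * d)) = (\<not> thue_morse (g + d))"
  "thue_morse (Suc (Suc (2 * g + 2 * d))) = thue_morse (Suc (g + d))"
  "thue_morse (Suc (Suc (Suc (2 * g + 2 * d)))) = (\<not> thue_morse (Suc (g + d)))"
  using thue_morse_double[of "g + d"] thue_morse_double[of "Suc (g + d)"] by simp_all

lemma tm_sum_double_add [simp]:
  "tm_sum (Suc (Suc (2 * g))) = 0"
  "tm_sum (2 * g + 2 * d) = 0"
  "tm_sum (Suc (2 * g + 2 * d)) = tm_sign (g + d)"
  "tm_sum (Suc (Suc (2 * g + 2 * d))) = 0"
  "tm_sum (Suc (Suc (Suc (2 * g + 2 * d)))) = tm_sign (Suc (g + d))"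
  using tm_sum_double[of "g + d"] tm_sum_double[of "Suc (g + d)"] tm_sum_double[of "Suc g"]
  by simp_all

section \<open>Number of codes for each way of cutting the ends\<close>

abbreviation bool_sign :: "bool \<Rightarrow> int" where
  "bool_sign b \<equiv> if b then - 1 else 1"

lemma card_codes_aligned:
  assumes "l \<ge> 2"
  shows "card (range (\<lambda>h. (False, False, tm_sum (h + l) - tm_sum h))) = (if even l then 3 else 2)"
proof (cases "even l")
  case True
  then obtain d where d: "l = 2 * d" "d \<ge> 1" using assms by (auto elim!: evenE)
  have "range (\<lambda>h. (False, False, tm_sum (h + l) - tm_sum h)) =
      {(False, False, 0), (False, False, 2), (False, False, - 2)}"
    by (subst range_by_parity[OF d(2) d(2), where F = "\<lambda>a b. (False, False, 0)"
          and G = "\<lambda>a b. (False, False, bool_sign b - bool_sign a)"])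
      (auto simp: d tm_sign_def)
  then show ?thesis using True by simp
next
  case False
  then obtain d where d: "l = Suc (2 * d)" "d \<ge> 1" using assms by (auto elim!: oddE)
  have "range (\<lambda>h. (False, False, tm_sum (h + l) - tm_sum h)) = {(False, False, 1), (False, False, - 1)}"
    by (subst range_by_parity[OF d(2) d(2), where F = "\<lambda>a b. (False, False, bool_sign b)"
          and G = "\<lambda>a b. (False, False, - bool_sign a)"])
      (auto simp: d tm_sign_def)
  then show ?thesis using False by simp
qed

lemma card_codes_left_aligned:
  assumes "l \<ge> 2"
  shows "card (range (\<lambda>h. (False, thue_morse (h + l), tm_sum (h + l) - tm_sum h))) = 4"
    (is "card (range ?f) = 4")
proof (cases "even l")
  case True
  then obtain d where d: "l = 2 * d" "d \<ge> 1" using assms by (auto elim!: evenE)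
  have "range ?f = {(False, False, 0), (False, True, 0), (False, False, - 2), (False, True, 2)}"
    by (subst range_by_parity[OF d(2) d(2), where F = "\<lambda>a b. (False, b, 0)"
          and G = "\<lambda>a b. (False, \<not> b, bool_sign b - bool_sign a)"])
      (auto simp: d tm_sign_def)
  then show ?thesis by simp
next
  case False
  then obtain d where d: "l = Suc (2 * d)" "d \<ge> 1" using assms by (auto elim!: oddE)
  have "range ?f = {(False, True, 1), (False, False, - 1), (False, True, - 1), (False, False, 1)}"
    \<comment> \<open>For odd \<open>h = Suc (2 * g)\<close> the right end is
      \<open>2 * (g + Suc d)\<close>, hence the distance \<open>Suc d\<close>.\<close>
    by (subst range_by_parity[OF d(2), of "Suc d", where F = "\<lambda>a b. (False, \<not> b, bool_sign b)"
          and G = "\<lambda>a b. (False, b, - bool_sign a)"])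
      (auto simp: d tm_sign_def)
  then show ?thesis by simp
qed

lemma card_codes_right_aligned:
  assumes "l \<ge> 3"
  shows "card (range (\<lambda>h. (thue_morse h, False, tm_sum (h + l) - tm_sum (Suc h)))) = 4"
    (is "card (range ?f) = 4")
proof (cases "even l")
  case True
  then obtain c where c: "l = 2 * c" "c \<ge> 1" using assms by (auto elim!: evenE)
  then obtain d where d: "l = Suc (Suc (2 * d))" by (cases c) auto
  have "range ?f = {(False, False, - 1), (True, False, 1), (True, False, - 1), (False, False, 1)}"
    \<comment> \<open>For even \<open>h\<close> only the first letter enters, so any positive
      distance serves.\<close>
    by (subst range_by_parity[of 1 "Suc d", where F = "\<lambda>a b. (a, False, - bool_sign a)"
          and G = "\<lambda>a b. (\<not> a, False, bool_sign b)"])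
      (auto simp: d tm_sign_def)
  then show ?thesis by simp
next
  case False
  then obtain d where d: "l = Suc (2 * d)" "d \<ge> 1" using assms by (auto elim!: oddE)
  have "range ?f = {(False, False, 0), (False, False, - 2), (True, False, 2), (True, False, 0)}"
    by (subst range_by_parity[OF d(2) d(2), where F = "\<lambda>a b. (a, False, bool_sign b - bool_sign a)"
          and G = "\<lambda>a b. (\<not> a, False, 0)"])
      (auto simp: d tm_sign_def)
  then show ?thesis by simp
qed

text \<open>Each parity of \<open>h\<close> contributes four triples, and two of them are common to
  both.\<close>

lemma card_codes_unaligned:
  assumes "l \<ge> 2"
  shows "card (range (\<lambda>h. (thue_morse h, thue_morse (h + l), tm_sum (h + l) - tm_sum (Suc h)))) = 6"
    (is "card (range ?f) = 6")
proof (cases "even l")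
  case True
  then obtain c where c: "l = 2 * c" "c \<ge> 1" using assms by (auto elim!: evenE)
  then obtain d where d: "l = Suc (Suc (2 * d))" by (cases c) auto
  have "range ?f = {(False, False, - 1), (False, True, - 1), (True, False, 1), (True, True, 1),
      (True, False, - 1), (False, True, 1)}"
    by (subst range_by_parity[of "Suc d" "Suc d", where F = "\<lambda>a b. (a, b, - bool_sign a)"
          and G = "\<lambda>a b. (\<not> a, \<not> b, bool_sign b)"])
      (auto simp: d tm_sign_def)
  then show ?thesis by simp
next
  case False
  then obtain d where d: "l = Suc (2 * d)" "d \<ge> 1" using assms by (auto elim!: oddE)
  have "range ?f = {(False, True, 0), (False, False, - 2), (True, True, 2), (True, False, 0),
      (True, True, 0), (False, False, 0)}"
    by (subst range_by_parity[OF d(2), of "Suc d",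
          where F = "\<lambda>a b. (a, \<not> b, bool_sign b - bool_sign a)"
          and G = "\<lambda>a b. (\<not> a, b, 0)"])
      (auto simp: d tm_sign_def)
  then show ?thesis by simp
qed

section \<open>Codes at a given offset\<close>

text \<open>Letters at uncut ends are masked by \<open>False\<close>. The difference of partial sums
  encodes the number of zeros of the inner word, whose length depends only on \<open>r\<close> and
  \<open>n\<close>.\<close>

definition offset_codes :: "nat \<Rightarrow> nat \<Rightarrow> nat \<Rightarrow> (bool \<times> bool \<times> int) set" where
  "offset_codes q n r = range (\<lambda>h. (r \<noteq> 0 \<and> thue_morse h,
     (r + n) mod q \<noteq> 0 \<and> thue_morse (h + (r + n) div q),
     tm_sum (h + (r + n) div q) - tm_sum (h + of_bool (r \<noteq> 0))))"

lemma card_offset_codes: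
  assumes "2 * q \<le> n" "r < q"
  shows "card (offset_codes q n r) =
    (if r = 0 then if n mod q = 0 then if even (n div q) then 3 else 2 else 4
     else if (r + n) mod q = 0 then 4 else 6)"
proof -
  have l: "(r + n) div q \<ge> 2" and q: "q > 0"
    using assms by (simp_all add: less_eq_div_iff_mult_less_eq)
  show ?thesis
  proof (cases "r = 0")
    case True
    then show ?thesis
      using l card_codes_aligned[of "n div q"] card_codes_left_aligned[of "n div q"]
      by (cases "n mod q = 0") (simp_all add: offset_codes_def)
  next
    case False
    show ?thesis
    proof (cases "(r + n) mod q = 0")
      case True
      then have "r + n = q * ((r + n) div q)" by auto
      then have "q * 2 < q * ((r + n) div q)" using False assms(1) by linarith
      then have "(r + n) div q \<ge> 3" by simp
      then show ?thesis
        using False True card_codes_right_aligned[of "(r + n) div q"] by (simp add: offset_codes_def)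
    next
      case nz: False
      then show ?thesis
        using False l card_codes_unaligned[of "(r + n) div q"] by (simp add: offset_codes_def)
    qed
  qed
qed

text \<open>If \<open>q\<close> divides \<open>n\<close>, offset 0 gives 3 or 2 codes and each of
  the other \<open>q - 1\<close> offsets gives 6. Otherwise offset 0 and the unique offset
  \<open>s\<close> with aligned right end give 4 each, and the remaining \<open>q - 2\<close> give
  6.\<close>

lemma sum_card_offset_codes:
  assumes "2 * q \<le> n" "q > 0"
  shows "(\<Sum>r<q. card (offset_codes q n r)) = (if 2 * q dvd n then 6 * q - 3 else 6 * q - 4)"
proof (cases "n mod q = 0")
  case True
  have "(\<Sum>r\<in>{..<q} - {0}. card (offset_codes q n r)) = (\<Sum>r\<in>{..<q} - {0}. 6)"
  proof (rule sum.cong)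
    fix r assume r: "r \<in> {..<q} - {0}"
    have "(r + n) mod q = r mod q" using True by (metis add.right_neutral mod_add_right_eq)
    then show "card (offset_codes q n r) = 6" using r assms(1) by (simp add: card_offset_codes)
  qed simp
  also have "\<dots> = 6 * (q - 1)" using assms(2) by (simp add: card_Diff_subset)
  finally have "(\<Sum>r<q. card (offset_codes q n r)) = card (offset_codes q n 0) + 6 * (q - 1)"
    using sum.remove[of "{..<q}" 0 "\<lambda>r. card (offset_codes q n r)"] assms(2) by simp
  moreover have "even (n div q) \<longleftrightarrow> 2 * q dvd n"
    using True assms(2) by (metis dvd_div_iff_mult mod_0_imp_dvd less_numeral_extra(3))
  ultimately show ?thesis
    using True assms by (auto simp: card_offset_codes)
next
  case False
  define s where "s = q - n mod q"
  have s: "0 < s" "s < q" using False assms(2) by (simp_all add: s_def)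
  have zero: "(r + n) mod q = 0 \<longleftrightarrow> r = s" if "r < q" for r
  proof -
    have m: "n mod q < q" using assms(2) by simp
    have "(r + n) mod q = (r + n mod q) mod q" by (simp add: mod_simps)
    also have "\<dots> = 0 \<longleftrightarrow> r = s"
    proof (cases "r + n mod q < q")
      case True
      then show ?thesis using False by (simp add: s_def)
    next
      case ge: False
      have "(r + n mod q) mod q = (r + n mod q - q) mod q"
        using ge by (intro le_mod_geq) simp
      also have "\<dots> = r + n mod q - q" using that m by (intro mod_less) linarith
      finally have "(r + n mod q) mod q = r + n mod q - q" .
      then show ?thesis using ge m by (auto simp: s_def)
    qed
    finally show ?thesis .
  qed
  have "(\<Sum>r\<in>{..<q} - {0} - {s}. card (offset_codes q n r)) = (\<Sum>r\<in>{..<q} - {0} - {s}. 6)"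
    using assms(1) by (intro sum.cong) (simp_all add: card_offset_codes zero)
  also have "\<dots> = 6 * (q - 2)" using s by (simp add: card_Diff_subset)
  finally have "(\<Sum>r<q. card (offset_codes q n r)) = 4 + (4 + 6 * (q - 2))"
    using sum.remove[of "{..<q}" 0 "\<lambda>r. card (offset_codes q n r)"]
      sum.remove[of "{..<q} - {0}" s "\<lambda>r. card (offset_codes q n r)"] assms s False zero[OF s(2)]
    by (simp add: card_offset_codes)
  moreover have "\<not> 2 * q dvd n" using False by (metis dvd_mult_right dvd_imp_mod_0)
  ultimately show ?thesis using s by simp
qed

section \<open>A complete invariant of the classes\<close>

definition factor_code :: "nat \<Rightarrow> nat \<Rightarrow> nat \<Rightarrow> nat \<times> bool \<times> bool \<times> int" where
  "factor_code j n i = (i mod 2 ^ j,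
     i mod 2 ^ j \<noteq> 0 \<and> thue_morse (i div 2 ^ j),
     (i + n) mod 2 ^ j \<noteq> 0 \<and> thue_morse ((i + n) div 2 ^ j),
     tm_sum ((i + n) div 2 ^ j) - tm_sum (i div 2 ^ j + of_bool (i mod 2 ^ j \<noteq> 0)))"

lemma count_inner_word:
  assumes "2 ^ j \<le> n"
  shows "2 * int (count_list (inner_word j n i) False) = int (length (inner_word j n i))
     + tm_sum ((i + n) div 2 ^ j) - tm_sum (i div 2 ^ j + of_bool (i mod 2 ^ j \<noteq> 0))"
proof -
  define h d l where "h = i div 2 ^ j" and "d = (of_bool (i mod 2 ^ j \<noteq> 0) :: nat)"
    and "l = (i mod 2 ^ j + n) div 2 ^ j"
  have "l \<ge> 1" using assms by (simp add: l_def Suc_le_eq div_greater_zero_iff)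
  then have dl: "d + (l - d) = l" by (simp add: d_def of_bool_def)
  then have hl: "h + l = h + d + (l - d)" by simp
  have "(i + n) div 2 ^ j = h + d + (l - d)"
    unfolding h_def l_def by (rule trans[OF add_div_split hl[unfolded h_def l_def]])
  moreover have "inner_word j n i = tm_factor (l - d) (h + d)"
    unfolding inner_word_def h_def[symmetric] l_def[symmetric] d_def[symmetric] hl[symmetric] ..
  ultimately show ?thesis
    using count_segment[of "h + d" "l - d"] by (simp add: h_def d_def)
qed

text \<open>Within one frame the inner words have equal length, so equal partial-sum differences
  mean equal numbers of zeros.\<close>

lemma binomial_equiv_iff_factor_code:
  assumes n: "2 ^ Suc j \<le> n"
  shows "(tm_factor n i, tm_factor n i') \<in> binomial_equiv (Suc j) \<longleftrightarrow>
    factor_code j n i = factor_code j n i'"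
proof -
  define x where "x i = tm_sum ((i + n) div 2 ^ j)
    - tm_sum (i div 2 ^ j + of_bool (i mod 2 ^ j \<noteq> 0))" for i
  have "2 ^ j \<le> n" using n by simp
  then have c: "2 * int (count_list (inner_word j n i) False) = int (length (inner_word j n i)) + x i" for i
    using count_inner_word[of j n i] by (simp add: x_def)
  have "(i + n) mod 2 ^ j = (i' + n) mod 2 ^ j" if "i mod 2 ^ j = i' mod 2 ^ j"
    using that by (metis mod_add_left_eq)
  then have "factor_code j n i = factor_code j n i' \<longleftrightarrow> same_frame j n i i' \<and> x i = x i'"
    unfolding same_frame_def factor_code_def x_def[symmetric] prod.inject by metis
  moreover have "x i = x i' \<longleftrightarrow> count_list (inner_word j n i) False = count_list (inner_word j n i') False"
    if "same_frame j n i i'"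
    using c[of i] c[of i'] length_inner_word[OF that] by linarith
  ultimately show ?thesis using binomial_equiv_iff_same_frame[OF n] by blast
qed

lemma range_factor_code:
  "range (factor_code j n) = Sigma {..<2 ^ j} (offset_codes (2 ^ j) n)"
proof (intro equalityI subsetI)
  fix y assume "y \<in> range (factor_code j n)"
  then obtain i where y: "y = factor_code j n i" by blast
  have "(i + n) mod 2 ^ j = (i mod 2 ^ j + n) mod 2 ^ j" by (simp add: mod_simps)
  then show "y \<in> Sigma {..<2 ^ j} (offset_codes (2 ^ j) n)"
    unfolding y factor_code_def offset_codes_def add_div_split[of i n] by auto
next
  fix y assume "y \<in> Sigma {..<2 ^ j} (offset_codes (2 ^ j) n)"
  then obtain r h where r: "r < 2 ^ j" and y: "y = (r, r \<noteq> 0 \<and> thue_morse h,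
     (r + n) mod 2 ^ j \<noteq> 0 \<and> thue_morse (h + (r + n) div 2 ^ j),
     tm_sum (h + (r + n) div 2 ^ j) - tm_sum (h + of_bool (r \<noteq> 0)))"
    by (auto simp: offset_codes_def)
  have "(2 ^ j * h + r) mod 2 ^ j = r" "(2 ^ j * h + r) div 2 ^ j = h" using r by simp_all
  moreover have "(2 ^ j * h + r + n) mod 2 ^ j = (r + n) mod 2 ^ j"
    by (simp add: add.assoc)
  ultimately have "y = factor_code j n (2 ^ j * h + r)"
    unfolding y factor_code_def add_div_split[of "2 ^ j * h + r" n] by simp
  then show "y \<in> range (factor_code j n)" by blast
qed

text \<open>Both ranges are in bijection with the domain modulo the common kernel.\<close>

lemma card_range_cong:
  assumes "\<And>i i'. f i = f i' \<longleftrightarrow> g i = g i'"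
  shows "card (range f) = card (range g)"
proof (rule bij_betw_same_card)
  have *: "g (inv f (f i)) = g i" for i
    using assms by (metis f_inv_into_f rangeI)
  show "bij_betw (\<lambda>y. g (inv f y)) (range f) (range g)"
    unfolding bij_betw_def inj_on_def image_image using assms by (auto simp: *)
qed

lemma card_quotient_range:
  assumes R: "\<And>i i'. (f i, f i') \<in> R \<longleftrightarrow> g i = g i'"
  shows "card (range f // (R \<inter> range f \<times> range f)) = card (range g)"
proof -
  let ?Q = "\<lambda>i. (R \<inter> range f \<times> range f) `` {f i}"
  have Q: "?Q i = f ` {x. g i = g x}" for i using R by auto
  have "?Q i = ?Q i' \<longleftrightarrow> g i = g i'" for i i'
  proof
    assume eq: "?Q i = ?Q i'"
    have "f i \<in> ?Q i" unfolding Q by blast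
    then have "f i \<in> ?Q i'" by (simp only: eq)
    then have "(f i', f i) \<in> R" by simp
    then show "g i = g i'" using R by metis
  qed (simp add: Q)
  then have "card (range ?Q) = card (range g)" by (rule card_range_cong)
  moreover have "range f // (R \<inter> range f \<times> range f) = range ?Q"
    unfolding quotient_def by blast
  ultimately show ?thesis by simp
qed

lemma factors_thue_morse: "factors thue_morse n = range (tm_factor n)"
  by (auto simp: factors_def)

lemma card_quotient_thue_morse:
  assumes "\<And>i i'. (tm_factor n i, tm_factor n i') \<in> binomial_equiv k \<longleftrightarrow> g i = g i'"
  shows "binomial_complexity thue_morse k n = card (range g)"
  unfolding binomial_complexity_def factors_thue_morse
  using assms by (rule card_quotient_range)

theorem theorem2p6:
  fixes k :: nat
  assumes "k \<ge> 1"
  shows "(\<forall>n \<le> 2 ^ k - 1. binomial_complexity thue_morse k n = factor_complexity thue_morse n) \<and>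
    (\<forall>n \<ge> 2 ^ k. binomial_complexity thue_morse k n =
       (if [n = 0] (mod 2 ^ k) then 3 * 2 ^ k - 3 else 3 * 2 ^ k - 4))"
proof (intro conjI allI impI)
  fix n :: nat assume "n \<le> 2 ^ k - 1"
  moreover have "(2 :: nat) ^ k > 0" by simp
  ultimately have n: "n < 2 ^ k" by linarith
  have "(tm_factor n i, tm_factor n i') \<in> binomial_equiv k \<longleftrightarrow> tm_factor n i = tm_factor n i'" for i i'
    using binomial_equiv_short[OF n] by (auto simp: binomial_equiv_def)
  then show "binomial_complexity thue_morse k n = factor_complexity thue_morse n"
    unfolding factor_complexity_def factors_thue_morse by (rule card_quotient_thue_morse)
next
  fix n :: nat assume n: "n \<ge> 2 ^ k"
  obtain j where j: "k = Suc j" using assms by (cases k) auto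
  have "binomial_complexity thue_morse k n = card (range (factor_code j n))"
    unfolding j using n[unfolded j] binomial_equiv_iff_factor_code
    by (intro card_quotient_thue_morse) blast
  also have "\<dots> = (\<Sum>r<2 ^ j. card (offset_codes (2 ^ j) n r))"
    unfolding range_factor_code
  proof (rule card_SigmaI)
    show "\<forall>r\<in>{..<2 ^ j}. finite (offset_codes (2 ^ j) n r)"
      \<comment> \<open>Finiteness follows from the cardinality being positive.\<close>
      using card_offset_codes[of "2 ^ j" n] n j by (auto intro!: card_ge_0_finite)
  qed simp
  \<comment> \<open>Here \<open>q = 2 ^ j\<close>, so \<open>2 * q = 2 ^ k\<close> and
    \<open>6 * q = 3 * 2 ^ k\<close>.\<close>
  also have "\<dots> = (if 2 ^ k dvd n then 6 * 2 ^ j - 3 else 6 * 2 ^ j - 4)"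
    using sum_card_offset_codes[of "2 ^ j" n] n j by simp
  finally show "binomial_complexity thue_morse k n =
      (if [n = 0] (mod 2 ^ k) then 3 * 2 ^ k - 3 else 3 * 2 ^ k - 4)"
    by (simp add: j cong_0_iff)
qed

end
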